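(* Suppose that $\mathbb{E}\|Z\| < \infty$, and let $\mu := \mathbb{E} Z$. Then \[ \lim_{n\to\infty} n^{-1} L_n = 2\|\mu\|, \quad \text{almost surely and in } L^1. \] On the other hand, if $\mathbb{E}\|Z\| = \infty$, then $\limsup_{n\to\infty} n^{-1} L_n = \infty$ almost surely.
   Context: Let $Z, Z_1, Z_2, \ldots$ be i.i.d. random variables in $\mathbb{R}^2$, and let $S_0 := \mathbf{0}$ (the origin) and $S_n := \sum_{k=1}^n Z_k$ for $n \ge 1$. Let $\mathcal{H}_n$ be the convex hull of $\{S_0, S_1, \ldots, S_n\}$, and let $L_n$ be the perimeter length of $\mathcal{H}_n$. (If $\mathcal{H}_n$ is a line segment, possibly degenerate, its perimeter length is twice the length of the segment; in general, $L_n = \int_0^{2\pi} \max_{0\le k\le n} (S_k\cdot \mathbf{e}_\theta)\,d\theta$ with $\mathbf{e}_\theta = (\cos\theta,\sin\theta)$, by Cauchy's formula.) Here $\|\cdot\|$ is the Euclidean norm on $\mathbb{R}^2$. *)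

theory Defs
  imports "HOL-Probability.Probability"
begin

definition walk :: "(nat \<Rightarrow> 'a \<Rightarrow> real^2) \<Rightarrow> nat \<Rightarrow> 'a \<Rightarrow> real^2" where
  "walk Z n \<omega> = (\<Sum>k=1..n. Z k \<omega>)"

definition walk_hull :: "(nat \<Rightarrow> 'a \<Rightarrow> real^2) \<Rightarrow> nat \<Rightarrow> 'a \<Rightarrow> (real^2) set" where
  "walk_hull Z n \<omega> = convex hull ((\<lambda>k. walk Z k \<omega>) ` {0..n})"

(* Intended for polytopes in the plane (convex hulls of finite nonempty sets), which have only
   finitely many edges. A polytope with nonempty interior has as perimeter the total length of its
   edges (1-dimensional faces). The other case is that of a segment, possibly a single point, whose
   perimeter is by convention twice its length. The diameter of a segment is its length. *)
definition perimeter :: "(real^2) set \<Rightarrow> real" where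
  "perimeter K = (if aff_dim K = 2 then (\<Sum>F | F edge_of K. diameter F) else 2 * diameter K)"

definition hull_perimeter :: "(nat \<Rightarrow> 'a \<Rightarrow> real^2) \<Rightarrow> nat \<Rightarrow> 'a \<Rightarrow> real" where
  "hull_perimeter Z n \<omega> = perimeter (walk_hull Z n \<omega>)"

end

theory Submission
  imports Defs
begin

text \<open>
  The perimeter \<open>L\<^sub>n\<close> of the hull is controlled by an integral formula. For a direction \<open>x\<close> let \<open>width K x\<close> be the length of
  the projection \<open>(\<bullet>) x ` K\<close>. Up to finitely many exceptions, every line that is orthogonal to \<open>x\<close> and
  meets a plane polygon \<open>K\<close> with interior points crosses exactly two of its edges, so the projections
  of the edges cover the projection of \<open>K\<close> exactly twice, and \<open>width K x\<close> is half the sum of the widths of the edges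
  (\<open>sum_width_edges\<close>). The width of a segment from \<open>a\<close> to \<open>b\<close> is \<open>\<bar>x \<bullet> (b - a)\<bar>\<close>, whose integral over all
  \<open>x\<close> in the unit disc is, by rotation invariance, a constant times the length of the segment. Hence
  the perimeter is a constant multiple of the integral of the width over the disc
  (\<open>perimeter_eq_integral_width\<close>). This is Cauchy's formula with the disc in the place of the circle
  of directions.

  The width of the hull of \<open>s 0, \<dots>, s n\<close> is a maximum minus a minimum of the numbers \<open>x \<bullet> s k\<close>. The
  formula therefore shows that \<open>L\<^sub>n\<close> is measurable and gives the bounds
  \<open>2 * norm (Z n) \<le> L\<^sub>n \<le> 2 * (\<Sum>k=1..n. norm (Z k))\<close>. It also gives the limit: if \<open>s n / n\<close> tends to \<open>\<mu>\<close>,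
  the width divided by \<open>n\<close> tends to \<open>\<bar>x \<bullet> \<mu>\<bar>\<close>, as for the segment from \<open>0\<close> to \<open>\<mu>\<close>, and dominated
  convergence gives \<open>L\<^sub>n / n \<longlonglongrightarrow> 2 * norm \<mu>\<close> (\<open>tendsto_perimeter_hull\<close>).

  If \<open>Z\<close> is integrable, the strong law of large numbers supplies \<open>S\<^sub>n / n \<longlonglongrightarrow> \<mu>\<close> almost surely. It is
  proved here from the recursion of the running maximum of a random walk: if the mean of the steps is
  negative, the partial sums are bounded above almost surely (\<open>iid_negative_mean_bdd_above\<close>). For the
  convergence in \<open>L\<^sup>1\<close>, the upper bound dominates \<open>L\<^sub>n / n\<close> by averages that converge almost surely by
  the strong law and have convergent means, which suffices by a generalized dominated convergence
  theorem.

  If \<open>Z\<close> is not integrable, the probabilities of \<open>norm (Z n) \<ge> c * n\<close> have divergent sum for every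
  \<open>c > 0\<close>, so by the second Borel--Cantelli lemma infinitely many of these events occur, and each of
  them with \<open>n \<ge> 1\<close> forces \<open>L\<^sub>n / n \<ge> 2 * c\<close>.
\<close>

section \<open>Widths of convex sets\<close>

text \<open>
  The length of the projection of \<open>K\<close> to the line spanned by \<open>x\<close>, scaled by \<open>norm x\<close>. For a unit
  vector \<open>x\<close> this is the usual width of \<open>K\<close> in the direction \<open>x\<close>; allowing all \<open>x\<close> makes it possible to
  average over a disc.
\<close>
definition width :: "'a::euclidean_space set \<Rightarrow> 'a \<Rightarrow> real" where
  "width K x = Sup ((\<bullet>) x ` K) - Inf ((\<bullet>) x ` K)"

lemma inner_image_eq_interval:
  assumes "compact K" "convex K" "K \<noteq> {}"
  shows "(\<bullet>) x ` K = {Inf ((\<bullet>) x ` K)..Sup ((\<bullet>) x ` K)}"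
    and "Inf ((\<bullet>) x ` K) \<le> Sup ((\<bullet>) x ` K)"
proof -
  have "continuous_on K ((\<bullet>) x)" by (intro continuous_intros)
  then have "compact ((\<bullet>) x ` K)" "connected ((\<bullet>) x ` K)"
    using assms by (auto intro: compact_continuous_image connected_continuous_image convex_connected)
  then obtain a b where "(\<bullet>) x ` K = {a..b}" using connected_compact_interval_1 by metis
  moreover from this \<open>K \<noteq> {}\<close> have "a \<le> b" by auto
  ultimately show "(\<bullet>) x ` K = {Inf ((\<bullet>) x ` K)..Sup ((\<bullet>) x ` K)}"
    and "Inf ((\<bullet>) x ` K) \<le> Sup ((\<bullet>) x ` K)" by auto
qed

lemma width_eq_measure:
  assumes "compact K" "convex K" "K \<noteq> {}"
  shows "width K x = measure lborel ((\<bullet>) x ` K)"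
proof -
  have "measure lborel ((\<bullet>) x ` K) = measure lborel {Inf ((\<bullet>) x ` K)..Sup ((\<bullet>) x ` K)}"
    using inner_image_eq_interval(1)[OF assms] by simp
  then show ?thesis using inner_image_eq_interval(2)[OF assms, of x] by (simp add: width_def)
qed

lemma width_segment: "width (closed_segment a b) x = \<bar>x \<bullet> (b - a)\<bar>"
proof -
  have "linear ((\<bullet>) x)"
    by (simp add: bounded_linear.linear bounded_linear_inner_right)
  then have "(\<bullet>) x ` closed_segment a b = closed_segment (x \<bullet> a) (x \<bullet> b)"
    by (metis closed_segment_linear_image)
  then show ?thesis
    by (simp add: width_def closed_segment_eq_real_ivl inner_diff_right)
qed

lemma width_convex_hull:
  assumes "finite S" "S \<noteq> {}"
  shows "width (convex hull S) x = Max ((\<bullet>) x ` S) - Min ((\<bullet>) x ` S)"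
proof -
  have "Sup ((\<bullet>) x ` (convex hull S)) = Max ((\<bullet>) x ` S)"
  proof (rule cSup_eq_maximum)
    show "Max ((\<bullet>) x ` S) \<in> (\<bullet>) x ` (convex hull S)"
      using assms hull_subset[of S convex] by (intro subsetD[OF image_mono Max_in]) auto
    have "convex hull S \<subseteq> {y. x \<bullet> y \<le> Max ((\<bullet>) x ` S)}"
      using assms by (intro hull_minimal convex_halfspace_le) auto
    then show "t \<le> Max ((\<bullet>) x ` S)" if "t \<in> (\<bullet>) x ` (convex hull S)" for t
      using that by auto
  qed
  moreover have "Inf ((\<bullet>) x ` (convex hull S)) = Min ((\<bullet>) x ` S)"
  proof (rule cInf_eq_minimum)
    show "Min ((\<bullet>) x ` S) \<in> (\<bullet>) x ` (convex hull S)"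
      using assms hull_subset[of S convex] by (intro subsetD[OF image_mono Min_in]) auto
    have "convex hull S \<subseteq> {y. x \<bullet> y \<ge> Min ((\<bullet>) x ` S)}"
      using assms by (intro hull_minimal convex_halfspace_ge) auto
    then show "Min ((\<bullet>) x ` S) \<le> t" if "t \<in> (\<bullet>) x ` (convex hull S)" for t
      using that by auto
  qed
  ultimately show ?thesis by (simp add: width_def)
qed

lemma inner_diff_le_width:
  assumes "bounded K" "y \<in> K" "z \<in> K"
  shows "x \<bullet> y - x \<bullet> z \<le> width K x"
proof -
  have "bounded ((\<bullet>) x ` K)"
    using assms(1) by (simp add: bounded_linear_image bounded_linear_inner_right)
  then have "x \<bullet> y \<le> Sup ((\<bullet>) x ` K)" "Inf ((\<bullet>) x ` K) \<le> x \<bullet> z"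
    using assms by (auto intro!: cSup_upper cInf_lower bounded_imp_bdd_above bounded_imp_bdd_below)
  then show ?thesis by (simp add: width_def)
qed

lemma width_leI:
  assumes "K \<noteq> {}" "\<And>y z. y \<in> K \<Longrightarrow> z \<in> K \<Longrightarrow> x \<bullet> y - x \<bullet> z \<le> c"
  shows "width K x \<le> c"
proof -
  have "Sup ((\<bullet>) x ` K) \<le> c + x \<bullet> z" if "z \<in> K" for z
    using assms(1) assms(2)[OF _ that] by (intro cSup_least) (auto simp: algebra_simps)
  then have "Sup ((\<bullet>) x ` K) - c \<le> Inf ((\<bullet>) x ` K)"
    using assms(1) by (intro cInf_greatest) (auto simp: algebra_simps)
  then show ?thesis by (simp add: width_def)
qed

section \<open>Edges of a polygon and the lines that cross them\<close>

lemma edge_of_polytope_segment: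
  assumes "polytope K" "F edge_of K"
  obtains a b where "a \<noteq> b" "F = closed_segment a b"
proof -
  have "polytope F" "aff_dim F = 1"
    using assms face_of_polytope_polytope by (auto simp: edge_of_def)
  then have "F \<noteq> {}" "collinear F" by (auto simp: collinear_aff_dim)
  then obtain a b where ab: "F = closed_segment a b"
    using \<open>polytope F\<close> compact_convex_collinear_segment polytope_imp_compact polytope_imp_convex by metis
  with \<open>aff_dim F = 1\<close> have "a \<noteq> b" by auto
  with ab that show ?thesis by blast
qed

lemma finite_edges: "polytope K \<Longrightarrow> finite {F. F edge_of K}"
  using finite_polytope_faces[of K] by (auto simp: edge_of_def elim: rev_finite_subset)

text \<open>
  Two different edges meet in a common proper face of one of them, and such a face has dimension at
  most zero.
\<close>
lemma edges_Int_extreme_point: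
  assumes "polytope K" "F edge_of K" "G edge_of K" "F \<noteq> G" "q \<in> F" "q \<in> G"
  shows "q extreme_point_of K"
proof -
  have FG: "F \<inter> G face_of K" using assms by (simp add: edge_of_def face_of_Int)
  have *: "aff_dim (A \<inter> B) < 1" if "A edge_of K" "B edge_of K" "A \<inter> B \<noteq> A" for A B
  proof -
    have "A \<inter> B face_of A"
      using that by (meson edge_of_def face_of_Int face_of_subset edge_of_imp_subset inf_le1)
    then show ?thesis
      using face_of_aff_dim_lt[of A "A \<inter> B"] that by (auto simp: edge_of_def face_of_imp_convex)
  qed
  have "F \<inter> G \<noteq> F \<or> G \<inter> F \<noteq> G" using \<open>F \<noteq> G\<close> by blast
  then have "aff_dim (F \<inter> G) < 1"
    using *[of F G] *[of G F] assms by (auto simp: Int_commute)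
  moreover have "aff_dim (F \<inter> G) \<ge> 0"
    using assms by (metis IntI aff_dim_negative_iff empty_iff linorder_not_le)
  ultimately have "aff_dim (F \<inter> G) = 0" by linarith
  then obtain a where "F \<inter> G = {a}" by (auto simp: aff_dim_eq_0)
  then show ?thesis using FG assms face_of_singleton by (metis IntI singletonD)
qed

text \<open>
  This is where the dimension of the plane enters: the vectors orthogonal to \<open>x\<close> are the
  multiples of one vector \<open>d\<close>, so there are only two directions in which a line through an interior
  point can leave a convex set. The direction \<open>d\<close> is \<open>x\<close> turned by a right
  angle.
\<close>
lemma orthogonal_line_real2:
  fixes x :: "real^2"
  assumes "x \<noteq> 0"
  obtains d :: "real^2" where "d \<noteq> 0" "x \<bullet> d = 0" "\<And>y. x \<bullet> y = 0 \<Longrightarrow> \<exists>s. y = s *\<^sub>R d"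
proof -
  define d :: "real^2" where "d = vector [- (x$2), x$1]"
  have d: "d $ 1 = - (x$2)" "d $ 2 = x $ 1" by (auto simp: d_def)
  have pos: "x$1 * x$1 + x$2 * x$2 > 0"
    using inner_gt_zero_iff[of x] assms by (simp add: inner_vec_def sum_2)
  show ?thesis
  proof
    show "d \<noteq> 0" using assms d by (auto simp: vec_eq_iff forall_2)
    show "x \<bullet> d = 0" by (simp add: inner_vec_def sum_2 d)
    fix y :: "real^2" assume "x \<bullet> y = 0"
    then have o: "x$1 * y$1 + x$2 * y$2 = 0" by (simp add: inner_vec_def sum_2)
    define N where "N = x$1 * x$1 + x$2 * x$2"
    \<comment> \<open>By Cramer's rule, as \<open>N\<close> is the determinant of the system with columns \<open>x\<close> and \<open>d\<close>.\<close>
    define s where "s = (x$1 * y$2 - x$2 * y$1) / N"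
    have "N \<noteq> 0" unfolding N_def using pos by linarith
    have "y$1 * N + x$2 * (x$1 * y$2 - x$2 * y$1) = x$1 * (x$1 * y$1 + x$2 * y$2)"
      "y$2 * N - x$1 * (x$1 * y$2 - x$2 * y$1) = x$2 * (x$1 * y$1 + x$2 * y$2)"
      by (simp_all add: N_def algebra_simps)
    then have "y$1 = - (x$2) * s" "y$2 = x$1 * s"
      using \<open>N \<noteq> 0\<close> unfolding s_def o by (simp_all add: field_simps)
    then have "y = s *\<^sub>R d" by (simp add: vec_eq_iff forall_2 d mult.commute)
    then show "\<exists>s. y = s *\<^sub>R d" ..
  qed
qed

lemma frontier_eq_Union_edges:
  fixes K :: "(real^2) set"
  assumes "polytope K" "aff_dim K = 2"
  shows "frontier K = \<Union>{F. F edge_of K}"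
proof -
  have con: "convex K" and ne: "K \<noteq> {}" using assms by (auto simp: polytope_imp_convex)
  have "interior K = rel_interior K"
    using assms(2) by (simp add: interior_rel_interior_gen)
  then have "interior K \<noteq> {}" using con ne by (simp add: rel_interior_eq_empty)
  then have "frontier K = rel_frontier K" by (simp add: rel_frontier_nonempty_interior)
  also have "\<dots> = \<Union>{F. F facet_of K}"
    by (simp add: assms polytope_imp_polyhedron rel_frontier_of_polyhedron)
  also have "{F. F facet_of K} = {F. F edge_of K}"
    using assms by (auto simp: facet_of_def edge_of_def)
  finally show ?thesis .
qed

text \<open>
  From the interior point \<open>p\<close>, the line orthogonal to \<open>x\<close> reaches the frontier once in each of its two
  directions. The frontier is the union of the edges. The two frontier points lie on different edges,
  since an edge containing both would contain \<open>p\<close>; and each lies on only one edge, since a common point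
  of two edges is an extreme point and no extreme point lies at this level.
\<close>
lemma card_edges_meeting_line:
  fixes K :: "(real^2) set"
  assumes K: "polytope K" "aff_dim K = 2" and "x \<noteq> 0"
    and p: "p \<in> interior K" and novertex: "\<And>v. v extreme_point_of K \<Longrightarrow> x \<bullet> v \<noteq> x \<bullet> p"
  shows "card {F. F edge_of K \<and> x \<bullet> p \<in> (\<bullet>) x ` F} = 2"
proof -
  have bnd: "bounded K" and con: "convex K" and cl: "closed K"
    using K by (auto simp: polytope_imp_bounded polytope_imp_convex polytope_imp_closed)
  obtain d where d: "d \<noteq> 0" "x \<bullet> d = 0" "\<And>y. x \<bullet> y = 0 \<Longrightarrow> \<exists>s. y = s *\<^sub>R d"
    using orthogonal_line_real2[OF \<open>x \<noteq> 0\<close>] by metis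
  have front: "frontier K = \<Union>{F. F edge_of K}" using frontier_eq_Union_edges K by blast
  have hit: "\<exists>s>0. p + s *\<^sub>R e \<in> frontier K \<and> (\<forall>t>0. p + t *\<^sub>R e \<in> frontier K \<longrightarrow> t = s)"
    if "e \<noteq> 0" for e
  proof -
    obtain s where s: "0 < s" "p + s *\<^sub>R e \<in> frontier K"
       "\<And>t. 0 \<le> t \<Longrightarrow> t < s \<Longrightarrow> p + t *\<^sub>R e \<in> interior K"
      using ray_to_frontier[OF bnd p \<open>e \<noteq> 0\<close>] by metis
    have "t = s" if t: "t > 0" "p + t *\<^sub>R e \<in> frontier K" for t
    proof (rule ccontr)
      assume "t \<noteq> s"
      with s(3)[of t] t have "s < t" by (force simp: frontier_def)
      have "p + t *\<^sub>R e \<in> K" using t cl by (simp add: frontier_def)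
      \<comment> \<open>Beyond \<open>s\<close> there is no frontier point: the open segment from \<open>p\<close> to it would be interior.\<close>
      have "p + s *\<^sub>R e = (p + t *\<^sub>R e) - (1 - s/t) *\<^sub>R ((p + t *\<^sub>R e) - p)"
        using t by (simp add: algebra_simps)
      also have "\<dots> \<in> interior K"
        using mem_interior_convex_shrink[OF con p \<open>p + t *\<^sub>R e \<in> K\<close>, of "1 - s/t"] \<open>s < t\<close> s(1)
        by simp
      finally show False using s(2) by (simp add: frontier_def)
    qed
    with s show ?thesis by blast
  qed
  obtain s1 where s1: "s1 > 0" "p + s1 *\<^sub>R d \<in> frontier K"
    "\<And>t. t > 0 \<Longrightarrow> p + t *\<^sub>R d \<in> frontier K \<Longrightarrow> t = s1" using hit[OF d(1)] by blast
  obtain s2 where s2: "s2 > 0" "p + s2 *\<^sub>R (-d) \<in> frontier K"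
    "\<And>t. t > 0 \<Longrightarrow> p + t *\<^sub>R (-d) \<in> frontier K \<Longrightarrow> t = s2" using hit[of "-d"] d(1) by auto
  define q1 q2 where "q1 = p + s1 *\<^sub>R d" and "q2 = p - s2 *\<^sub>R d"
  have q: "q1 \<in> frontier K" "q2 \<in> frontier K" "x \<bullet> q1 = x \<bullet> p" "x \<bullet> q2 = x \<bullet> p"
    using s1(1,2) s2(1,2) d(1,2) by (auto simp: q1_def q2_def inner_add_right inner_diff_right)
  have only: "y = q1 \<or> y = q2" if y: "y \<in> frontier K" "x \<bullet> y = x \<bullet> p" for y
  proof -
    obtain s where s: "y - p = s *\<^sub>R d" using d(3)[of "y - p"] y by (auto simp: inner_diff_right)
    then have y': "y = p + s *\<^sub>R d" by (simp add: algebra_simps)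
    consider "s = 0" | "s > 0" | "-s > 0" by linarith
    then show ?thesis
    proof cases
      case 1 then show ?thesis using y y' p by (auto simp: frontier_def)
    next
      case 2 then show ?thesis using s1(3) y y' by (auto simp: q1_def)
    next
      case 3 then show ?thesis using s2(3)[of "-s"] y y' by (auto simp: q2_def)
    qed
  qed
  obtain F1 F2 where F: "F1 edge_of K" "q1 \<in> F1" "F2 edge_of K" "q2 \<in> F2"
    using q front by blast
  have unique: "A = B" if "A edge_of K" "B edge_of K" "y \<in> A" "y \<in> B" "x \<bullet> y = x \<bullet> p" for A B y
    using edges_Int_extreme_point[OF K(1) that(1,2) _ that(3,4)] novertex that(5) by blast
  have "F1 \<noteq> F2"
  proof
    assume "F1 = F2"
    then have "convex F1" "q1 \<in> F1" "q2 \<in> F1"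
      using F by (auto simp: edge_of_def face_of_imp_convex)
    \<comment> \<open>These weights express \<open>p\<close> as a convex combination of the two frontier points.\<close>
    then have "(s2 / (s1 + s2)) *\<^sub>R q1 + (s1 / (s1 + s2)) *\<^sub>R q2 \<in> F1"
      using s1(1) s2(1) by (intro convexD) (auto simp flip: add_divide_distrib)
    also have "(s2 / (s1 + s2)) *\<^sub>R q1 + (s1 / (s1 + s2)) *\<^sub>R q2
        = (s2 / (s1 + s2) + s1 / (s1 + s2)) *\<^sub>R p"
      by (simp add: q1_def q2_def algebra_simps)
    also have "s2 / (s1 + s2) + s1 / (s1 + s2) = 1" using s1(1) s2(1) by (simp flip: add_divide_distrib)
    finally have "p \<in> frontier K" using F(1) unfolding front by auto
    with p show False by (simp add: frontier_def)
  qed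
  moreover have "{F. F edge_of K \<and> x \<bullet> p \<in> (\<bullet>) x ` F} = {F1, F2}"
  proof (intro equalityI subsetI)
    fix A assume "A \<in> {F. F edge_of K \<and> x \<bullet> p \<in> (\<bullet>) x ` F}"
    then obtain y where y: "A edge_of K" "y \<in> A" "x \<bullet> y = x \<bullet> p" by auto
    then have "y \<in> frontier K" unfolding front by blast
    with only y have "y = q1 \<or> y = q2" by blast
    then show "A \<in> {F1, F2}" using unique[OF y(1) _ y(2) _ y(3)] F by blast
  next
    fix A assume "A \<in> {F1, F2}"
    then show "A \<in> {F. F edge_of K \<and> x \<bullet> p \<in> (\<bullet>) x ` F}" using F q by (metis (mono_tags, lifting) image_eqI insertE mem_Collect_eq singletonD)
  qed
  ultimately show ?thesis by simp
qed

text \<open>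
  The exceptional levels \<open>t\<close> are the projections of the finitely many extreme points and the two ends of
  the projection of \<open>K\<close>. Any other level inside the projection is attained at an interior point.
\<close>
lemma AE_card_edges_meeting_line:
  fixes K :: "(real^2) set"
  assumes K: "polytope K" "aff_dim K = 2" and "x \<noteq> 0"
  shows "AE t in lborel. (\<Sum>F | F edge_of K. indicator ((\<bullet>) x ` F) t) = (2 * indicator ((\<bullet>) x ` K) t :: real)"
proof -
  have comp: "compact K" and con: "convex K" and ne: "K \<noteq> {}"
    using K by (auto simp: polytope_imp_compact polytope_imp_convex)
  define a b where "a = Inf ((\<bullet>) x ` K)" and "b = Sup ((\<bullet>) x ` K)"
  have img: "(\<bullet>) x ` K = {a..b}"
    unfolding a_def b_def by (rule inner_image_eq_interval[OF comp con ne])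
  have fin: "finite ((\<bullet>) x ` {v. v extreme_point_of K} \<union> {a, b})"
    using K(1) finite_polyhedron_extreme_points polytope_imp_polyhedron by blast
  have lin: "linear ((\<bullet>) x)"
    by (simp add: bounded_linear.linear bounded_linear_inner_right)
  have int: "interior K = rel_interior K"
    using K(2) by (simp add: interior_rel_interior_gen)
  have "(\<Sum>F | F edge_of K. indicator ((\<bullet>) x ` F) t) = (2 * indicator ((\<bullet>) x ` K) t :: real)"
    if t: "t \<notin> (\<bullet>) x ` {v. v extreme_point_of K} \<union> {a, b}" for t
  proof (cases "t \<in> {a..b}")
    case False
    then have "t \<notin> (\<bullet>) x ` F" if "F edge_of K" for F
      using edge_of_imp_subset[OF that] img by blast
    with False img show ?thesis by (simp add: indicator_def)
  next
    case True
    with t have "t \<in> interior {a..b}" by auto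
    also have "interior {a..b} = rel_interior ((\<bullet>) x ` K)"
      unfolding img using calculation
      by (metis empty_iff interior_rel_interior rel_interior_nonempty_interior)
    also have "\<dots> = (\<bullet>) x ` interior K"
      using rel_interior_convex_linear_image[OF lin con] int by simp
    finally obtain p where p: "p \<in> interior K" "t = x \<bullet> p" by auto
    have "(\<Sum>F | F edge_of K. indicator ((\<bullet>) x ` F) t :: real)
        = real (card {F. F edge_of K \<and> t \<in> (\<bullet>) x ` F})"
      using finite_edges[OF K(1)] by (simp add: indicator_def sum.If_cases Collect_conj_eq)
    also have "\<dots> = 2"
      unfolding p(2) using t p(2)
      by (subst card_edges_meeting_line[OF K \<open>x \<noteq> 0\<close> p(1)]) (auto simp: image_iff)
    finally show ?thesis using True img by simp
  qed
  moreover have "AE t in lborel. t \<notin> (\<bullet>) x ` {v. v extreme_point_of K} \<union> {a, b}"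
    using fin by (intro AE_not_in finite_imp_null_set_lborel)
  ultimately show ?thesis by (auto elim: AE_mp)
qed

text \<open>
  Integrating over \<open>t\<close> the number of edges that the line at level \<open>t\<close> crosses. This is Crofton's
  argument for a fixed direction.
\<close>
lemma sum_width_edges:
  fixes K :: "(real^2) set"
  assumes K: "polytope K" "aff_dim K = 2"
  shows "(\<Sum>F | F edge_of K. width F x) = 2 * width K x"
proof (cases "x = 0")
  case True
  have "width F x = 0" if "F \<noteq> {}" for F
    using that True by (simp add: width_def image_constant_conv)
  moreover have "F \<noteq> {}" if "F edge_of K" for F using that by (auto simp: edge_of_def)
  moreover have "K \<noteq> {}" using K by auto
  ultimately show ?thesis by simp
next
  case False
  have w: "width F x = (\<integral>t. indicator ((\<bullet>) x ` F) t \<partial>lborel)"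
      "integrable lborel (indicator ((\<bullet>) x ` F) :: real \<Rightarrow> real)"
    if "polytope F" "F \<noteq> {}" for F
  proof -
    have F: "compact F" "convex F" "F \<noteq> {}"
      using that by (auto simp: polytope_imp_compact polytope_imp_convex)
    show "width F x = (\<integral>t. indicator ((\<bullet>) x ` F) t \<partial>lborel)" using width_eq_measure[OF F] by simp
    obtain a b where "(\<bullet>) x ` F = {a..b}" using inner_image_eq_interval(1)[OF F] by blast
    then show "integrable lborel (indicator ((\<bullet>) x ` F) :: real \<Rightarrow> real)"
      by (simp add: integrable_indicator_iff emeasure_lborel_Icc_eq)
  qed
  have ne: "K \<noteq> {}" using K by auto
  have edge: "polytope F" "F \<noteq> {}" if "F edge_of K" for F
    using that K face_of_polytope_polytope by (auto simp: edge_of_def)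
  have "(\<Sum>F | F edge_of K. width F x)
      = (\<Sum>F | F edge_of K. \<integral>t. indicator ((\<bullet>) x ` F) t \<partial>lborel)"
    using w(1) edge by (intro sum.cong) auto
  also have "\<dots> = (\<integral>t. (\<Sum>F | F edge_of K. indicator ((\<bullet>) x ` F) t) \<partial>lborel)"
    using w(2) edge by (intro Bochner_Integration.integral_sum[symmetric]) auto
  also have "\<dots> = (\<integral>t. 2 * indicator ((\<bullet>) x ` K) t \<partial>lborel)"
  proof (intro integral_cong_AE)
    show "(\<lambda>t. \<Sum>F | F edge_of K. indicator ((\<bullet>) x ` F) t :: real) \<in> borel_measurable lborel"
      using w(2) edge by (intro borel_measurable_sum borel_measurable_integrable) auto
    show "(\<lambda>t. 2 * indicator ((\<bullet>) x ` K) t :: real) \<in> borel_measurable lborel"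
      using w(2)[of K] K ne by (intro borel_measurable_times borel_measurable_const borel_measurable_integrable) auto
  qed (rule AE_card_edges_meeting_line[OF K False])
  also have "\<dots> = 2 * width K x"
    using w(1)[of K] K ne by simp
  finally show ?thesis .
qed

section \<open>The perimeter as an integral of widths\<close>

lemma diameter_closed_segment: "diameter (closed_segment a b) = dist a (b::'a::euclidean_space)"
proof (rule antisym)
  show "diameter (closed_segment a b) \<le> dist a b"
  proof (rule diameter_le)
    fix x y assume "x \<in> closed_segment a b" "y \<in> closed_segment a b"
    then have "norm (x - y) \<le> norm (x - a) \<or> norm (x - y) \<le> norm (x - b)"
      "norm (x - a) \<le> dist a b" "norm (x - b) \<le> dist a b"
      using segment_furthest_le[of y a b x] dist_in_closed_segment[of x a b] by (auto simp: dist_norm)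
    then show "norm (x - y) \<le> dist a b" by linarith
  qed simp
  show "dist a b \<le> diameter (closed_segment a b)"
    by (rule diameter_bounded_bound) (auto intro: compact_imp_bounded)
qed

abbreviation unit_disc :: "(real^2) measure" where
  "unit_disc \<equiv> restrict_space lborel (cball 0 1)"

text \<open>
  The factor by which integration of \<open>\<bar>x \<bullet> v\<bar>\<close> over the unit disc multiplies the length of \<open>v\<close>.
\<close>
definition disc_abs_inner :: real where
  "disc_abs_inner = (\<integral>x. \<bar>x \<bullet> axis 1 1\<bar> \<partial>unit_disc)"

lemma finite_measure_unit_disc: "finite_measure unit_disc"
proof
  have "emeasure lborel (cball (0::real^2) 1) < \<infinity>"
    by (rule emeasure_lborel_cball_finite)
  then show "emeasure unit_disc (space unit_disc) \<noteq> \<infinity>"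
    by (simp add: emeasure_restrict_space)
qed

lemma space_unit_disc: "space unit_disc = cball 0 1"
  by (simp add: space_restrict_space)

lemma integrable_unit_disc:
  fixes f :: "real^2 \<Rightarrow> real"
  assumes "f \<in> borel_measurable borel" "\<And>x. norm x \<le> 1 \<Longrightarrow> \<bar>f x\<bar> \<le> B"
  shows "integrable unit_disc f"
proof -
  interpret finite_measure unit_disc by (rule finite_measure_unit_disc)
  show ?thesis
    using assms by (intro integrable_const_bound[of _ B])
      (auto intro!: AE_I2 measurable_restrict_space1 simp: space_unit_disc)
qed

text \<open>
  Orthogonal maps preserve the volume of boxes, and Lebesgue measure is determined by these volumes.
\<close>
lemma distr_lborel_orthogonal_transformation:
  fixes f :: "real^'n::{finite,wellorder} \<Rightarrow> real^'n::_"
  assumes f: "orthogonal_transformation f"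
  shows "distr lborel borel f = lborel"
proof (rule lborel_eqI[symmetric])
  have [measurable]: "f \<in> borel_measurable borel"
    using f by (simp add: linear_continuous_on linear_linear borel_measurable_continuous_onI orthogonal_transformation_linear)
  fix l u :: "real^'n::_" assume "\<And>b. b \<in> Basis \<Longrightarrow> l \<bullet> b \<le> u \<bullet> b"
  then have box: "emeasure lborel (box l u) = (\<Prod>b\<in>Basis. (u - l) \<bullet> b)" by simp
  define g where "g = inv f"
  have g: "orthogonal_transformation g"
    unfolding g_def by (rule orthogonal_transformation_inv[OF f])
  have vim: "f -` box l u = g ` box l u"
    unfolding g_def by (rule bij_vimage_eq_inv_image[OF orthogonal_transformation_bij[OF f]])
  have b: "f -` box l u \<in> sets borel" using measurable_sets_borel[of f borel "box l u"] by simp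
  have "emeasure (distr lborel borel f) (box l u) = emeasure lborel (f -` box l u)"
    by (simp add: emeasure_distr)
  also have "\<dots> = emeasure lebesgue (g ` box l u)"
    using b vim by simp
  also have "\<dots> = ennreal (measure lebesgue (g ` box l u))"
    using measurable_orthogonal_image[OF g lmeasurable_box] by (rule emeasure_eq_measure2)
  also have "\<dots> = ennreal (measure lebesgue (box l u))"
    by (simp add: measure_orthogonal_image[OF g lmeasurable_box])
  also have "\<dots> = emeasure lebesgue (box l u)"
    using emeasure_eq_measure2[OF lmeasurable_box] by metis
  finally show "emeasure (distr lborel borel f) (box l u) = (\<Prod>b\<in>Basis. (u - l) \<bullet> b)"
    using box by simp
qed simp

text \<open>
  An orthogonal map that takes a multiple of the first unit vector to \<open>v\<close> preserves the disc.
\<close>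
lemma integral_unit_disc_abs_inner:
  "(\<integral>x. \<bar>x \<bullet> v\<bar> \<partial>unit_disc) = disc_abs_inner * norm v"
proof -
  obtain f :: "real^2 \<Rightarrow> real^2" where f: "orthogonal_transformation f" "f (norm v *\<^sub>R axis 1 1) = v"
    by (rule orthogonal_transformation_exists[of "norm v *\<^sub>R axis 1 1" v]) auto
  have [measurable]: "f \<in> borel_measurable borel"
    using f(1) by (simp add: linear_continuous_on linear_linear borel_measurable_continuous_onI orthogonal_transformation_linear)
  have [measurable]: "cball (0::real^2) 1 \<in> sets borel" by simp
  have unit_disc: "(\<integral>x. g x \<partial>unit_disc) = (\<integral>x. indicator (cball 0 1) x * g x \<partial>lborel)" for g :: "real^2 \<Rightarrow> real"
    by (simp add: integral_restrict_space)
  have "(\<integral>x. \<bar>x \<bullet> v\<bar> \<partial>unit_disc) = (\<integral>x. indicator (cball 0 1) x * \<bar>x \<bullet> v\<bar> \<partial>distr lborel borel f)"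
    by (simp add: unit_disc distr_lborel_orthogonal_transformation[OF f(1)])
  also have "\<dots> = (\<integral>x. indicator (cball 0 1) (f x) * \<bar>f x \<bullet> f (norm v *\<^sub>R axis 1 1)\<bar> \<partial>lborel)"
    by (subst integral_distr) (simp_all add: f(2))
  also have "\<dots> = (\<integral>x. indicator (cball 0 1) x * \<bar>x \<bullet> (norm v *\<^sub>R axis 1 1 :: real^2)\<bar> \<partial>lborel)"
    using f(1) orthogonal_transformation_norm[OF f(1)]
    by (simp add: orthogonal_transformation_def indicator_def)
  also have "\<dots> = (\<integral>x. norm v * (indicator (cball 0 1) x * \<bar>x \<bullet> (axis 1 1 :: real^2)\<bar>) \<partial>lborel)"
    by (simp add: abs_mult mult_ac)
  also have "\<dots> = disc_abs_inner * norm v"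
    by (simp add: disc_abs_inner_def unit_disc)
  finally show ?thesis .
qed

text \<open>
  The integrand is at least \<open>1/4\<close> on a ball of radius \<open>1/4\<close> around the midpoint of the first unit vector.
\<close>
lemma disc_abs_inner_pos: "disc_abs_inner > 0"
proof -
  let ?e = "axis 1 1 :: real^2"
  interpret finite_measure unit_disc by (rule finite_measure_unit_disc)
  have int: "integrable unit_disc (\<lambda>x. \<bar>x \<bullet> ?e\<bar>)"
    by (rule integrable_unit_disc[of _ 1]) (auto intro: order_trans[OF Cauchy_Schwarz_ineq2])
  have ball: "ball (?e /\<^sub>R 2) (1/4) \<subseteq> cball 0 1" "\<And>x. x \<in> ball (?e /\<^sub>R 2) (1/4) \<Longrightarrow> 1/4 \<le> \<bar>x \<bullet> ?e\<bar>"
  proof -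
    fix x assume "x \<in> ball (?e /\<^sub>R 2) (1/4)"
    then have n: "norm (x - ?e /\<^sub>R 2) < 1/4" by (simp add: diameter_closed_segment dist_norm norm_minus_commute)
    have "\<bar>(x - ?e /\<^sub>R 2) \<bullet> ?e\<bar> \<le> norm (x - ?e /\<^sub>R 2) * norm ?e" by (rule Cauchy_Schwarz_ineq2)
    with n show "1/4 \<le> \<bar>x \<bullet> ?e\<bar>" by (simp add: inner_diff_left inner_axis_axis)
  next
    show "ball (?e /\<^sub>R 2) (1/4) \<subseteq> cball 0 1"
    proof
      fix x assume "x \<in> ball (?e /\<^sub>R 2) (1/4)"
      then have "norm (x - ?e /\<^sub>R 2) < 1/4" by (simp add: dist_norm norm_minus_commute)
      moreover have "norm x \<le> norm (x - ?e /\<^sub>R 2) + norm (?e /\<^sub>R 2)"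
        using norm_triangle_ineq[of "x - ?e /\<^sub>R 2" "?e /\<^sub>R 2"] by simp
      ultimately show "x \<in> cball 0 1" by simp
    qed
  qed
  have "0 < measure lborel (ball (?e /\<^sub>R 2) (1/4))"
    using content_ball_pos[of "1/4"] by simp
  also have "measure lborel (ball (?e /\<^sub>R 2) (1/4)) = measure unit_disc (ball (?e /\<^sub>R 2) (1/4))"
    using ball(1) by (simp add: measure_restrict_space)
  also have "\<dots> = 4 * (\<integral>x. 1/4 * indicator (ball (?e /\<^sub>R 2) (1/4)) x \<partial>unit_disc)"
    using ball(1) by (simp add: space_unit_disc Int_absorb2)
  also have "(\<integral>x. 1/4 * indicator (ball (?e /\<^sub>R 2) (1/4)) x \<partial>unit_disc) \<le> disc_abs_inner"
    unfolding disc_abs_inner_def using ball(2)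
    by (intro integral_mono int integrable_unit_disc[of _ "1/4"]) (auto simp: indicator_def)
  finally show ?thesis by simp
qed

text \<open>
  A polygon contributes the sum over its edges, whose widths add up to twice the width of \<open>K\<close>. A
  degenerate polygon is a single segment, and there the convention that the perimeter is twice the
  length yields the same factor two.
\<close>
theorem perimeter_eq_integral_width:
  assumes "polytope K" "K \<noteq> {}"
  shows "disc_abs_inner * perimeter K = 2 * (\<integral>x. width K x \<partial>unit_disc)"
proof -
  have seg: "(\<integral>x. width (closed_segment a b) x \<partial>unit_disc) = disc_abs_inner * diameter (closed_segment a b)"
    and segi: "integrable unit_disc (width (closed_segment a b))" for a b :: "real^2"
  proof -
    show "(\<integral>x. width (closed_segment a b) x \<partial>unit_disc) = disc_abs_inner * diameter (closed_segment a b)"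
      unfolding width_segment integral_unit_disc_abs_inner
      by (simp add: diameter_closed_segment dist_norm norm_minus_commute)
    have "\<bar>x \<bullet> (b - a)\<bar> \<le> norm (b - a)" if "norm x \<le> 1" for x
      using Cauchy_Schwarz_ineq2[of x "b - a"] mult_right_mono[OF that norm_ge_zero[of "b - a"]] by linarith
    then have "integrable unit_disc (\<lambda>x. \<bar>x \<bullet> (b - a)\<bar>)"
      by (intro integrable_unit_disc[of _ "norm (b - a)"]) auto
    then show "integrable unit_disc (width (closed_segment a b))"
      by (simp add: width_segment[abs_def])
  qed
  show ?thesis
  proof (cases "aff_dim K = 2")
    case True
    have "disc_abs_inner * perimeter K = (\<Sum>F | F edge_of K. disc_abs_inner * diameter F)"
      using True by (simp add: perimeter_def sum_distrib_left)
    also have "\<dots> = (\<Sum>F | F edge_of K. \<integral>x. width F x \<partial>unit_disc)"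
    proof (rule sum.cong)
      fix F assume "F \<in> {F. F edge_of K}"
      then obtain a b where "F = closed_segment a b"
        using edge_of_polytope_segment[OF assms(1)] by blast
      then show "disc_abs_inner * diameter F = (\<integral>x. width F x \<partial>unit_disc)" using seg by simp
    qed simp
    also have "\<dots> = (\<integral>x. (\<Sum>F | F edge_of K. width F x) \<partial>unit_disc)"
    proof (rule Bochner_Integration.integral_sum[symmetric])
      fix F assume "F \<in> {F. F edge_of K}"
      then obtain a b where "F = closed_segment a b"
        using edge_of_polytope_segment[OF assms(1)] by blast
      then show "integrable unit_disc (width F)" using segi by simp
    qed
    finally show ?thesis by (simp add: sum_width_edges[OF assms(1) True])
  next
    case False
    have "aff_dim K \<le> 2" using aff_dim_le_DIM[of K] by simp
    with False have "collinear K" by (simp add: collinear_aff_dim)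
    then obtain a b where "K = closed_segment a b"
      using assms compact_convex_collinear_segment polytope_imp_compact polytope_imp_convex by metis
    with False seg show ?thesis by (simp add: perimeter_def)
  qed
qed

corollary perimeter_eq:
  assumes "polytope K" "K \<noteq> {}"
  shows "perimeter K = 2 / disc_abs_inner * (\<integral>x. width K x \<partial>unit_disc)"
proof -
  have "perimeter K = (disc_abs_inner * perimeter K) / disc_abs_inner"
    using disc_abs_inner_pos by simp
  then show ?thesis unfolding perimeter_eq_integral_width[OF assms] by simp
qed

lemma integrable_width:
  fixes K :: "(real^2) set"
  assumes K: "polytope K" "K \<noteq> {}"
  shows "integrable unit_disc (width K)"
proof -
  obtain S where "finite S" "K = convex hull S" using K(1) unfolding polytope_def by blast
  moreover from this K(2) have "S \<noteq> {}" by auto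
  ultimately have S: "finite S" "K = convex hull S" "S \<noteq> {}" by auto
  have "width K = (\<lambda>x. Max ((\<lambda>y. x \<bullet> y) ` S) - Min ((\<lambda>y. x \<bullet> y) ` S))"
    using width_convex_hull[OF S(1,3)] S(2) by auto
  also have "\<dots> \<in> borel_measurable borel"
    using S(1) by (intro borel_measurable_diff borel_measurable_Max borel_measurable_Min) auto
  finally have meas: "width K \<in> borel_measurable borel" .
  obtain B where B: "\<And>y. y \<in> K \<Longrightarrow> norm y \<le> B"
    using polytope_imp_bounded[OF K(1)] by (auto simp: bounded_iff)
  show ?thesis
  proof (rule integrable_unit_disc[OF meas])
    fix x :: "real^2" assume x: "norm x \<le> 1"
    have ip: "\<bar>x \<bullet> y\<bar> \<le> B" if "y \<in> K" for y
    proof -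
      have "\<bar>x \<bullet> y\<bar> \<le> norm x * norm y" by (rule Cauchy_Schwarz_ineq2)
      also have "\<dots> \<le> 1 * B" using x B[OF that] by (intro mult_mono) auto
      finally show ?thesis by simp
    qed
    have "width K x \<le> 2 * B"
    proof (rule width_leI[OF K(2)])
      fix y z assume "y \<in> K" "z \<in> K"
      then show "x \<bullet> y - x \<bullet> z \<le> 2 * B" using ip[of y] ip[of z] by linarith
    qed
    moreover have "0 \<le> width K x"
      using K(2) inner_diff_le_width[OF polytope_imp_bounded[OF K(1)]] by (metis all_not_in_conv diff_self)
    ultimately show "\<bar>width K x\<bar> \<le> 2 * B" by simp
  qed
qed

text \<open>
  \<open>K\<close> is at least as wide as the segment from \<open>z\<close> to \<open>y\<close> in every direction.
\<close>
lemma perimeter_ge_double_dist: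
  assumes "polytope K" "y \<in> K" "z \<in> K"
  shows "2 * dist y z \<le> perimeter K"
proof -
  have ne: "K \<noteq> {}" and bnd: "bounded K" using assms polytope_imp_bounded by auto
  have "disc_abs_inner * (2 * dist y z) = 2 * (\<integral>x. \<bar>x \<bullet> (y - z)\<bar> \<partial>unit_disc)"
    by (simp add: integral_unit_disc_abs_inner dist_norm)
  also have "(\<integral>x. \<bar>x \<bullet> (y - z)\<bar> \<partial>unit_disc) = (\<integral>x. width (closed_segment z y) x \<partial>unit_disc)"
    by (simp add: width_segment)
  also have "\<dots> \<le> (\<integral>x. width K x \<partial>unit_disc)"
  proof (rule integral_mono)
    show "integrable unit_disc (width (closed_segment z y))"
      by (rule integrable_width) (auto simp: segment_convex_hull polytope_convex_hull)
    show "integrable unit_disc (width K)" by (rule integrable_width[OF assms(1) ne])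
    show "width (closed_segment z y) x \<le> width K x" for x
      using inner_diff_le_width[OF bnd, of y z x] inner_diff_le_width[OF bnd, of z y x] assms
      by (simp add: width_segment inner_diff_right abs_le_iff)
  qed
  also have "2 * (\<integral>x. width K x \<partial>unit_disc) = disc_abs_inner * perimeter K"
    using perimeter_eq_integral_width[OF assms(1) ne] by simp
  finally show ?thesis using disc_abs_inner_pos by simp
qed

section \<open>Perimeters of hulls of sequences\<close>

lemma polytope_hull_image: "polytope (convex hull (s ` {0..n::nat}))"
  by (simp add: polytope_convex_hull)

lemma width_hull_image:
  "width (convex hull (s ` {0..n::nat})) x
    = Max ((\<lambda>k. x \<bullet> s k) ` {0..n}) - Min ((\<lambda>k. x \<bullet> s k) ` {0..n})"
  by (subst width_convex_hull) (auto simp: image_image)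

lemma width_hull_attained:
  obtains i j where "i \<le> n" "j \<le> n" "width (convex hull (s ` {0..n::nat})) x = x \<bullet> s i - x \<bullet> s j"
proof -
  have "Max ((\<lambda>k. x \<bullet> s k) ` {0..n}) \<in> (\<lambda>k. x \<bullet> s k) ` {0..n}"
    "Min ((\<lambda>k. x \<bullet> s k) ` {0..n}) \<in> (\<lambda>k. x \<bullet> s k) ` {0..n}"
    by (intro Max_in Min_in; simp)+
  then show ?thesis using that unfolding width_hull_image image_iff by auto
qed

text \<open>
  The difference of two partial sums is the sum of a subset of the steps, up to sign, so each width of
  the hull is at most the sum of the widths of the steps.
\<close>
lemma perimeter_hull_partial_sums_le:
  fixes z :: "nat \<Rightarrow> real^2"
  shows "perimeter (convex hull ((\<lambda>k. \<Sum>i=1..k. z i) ` {0..n})) \<le> 2 * (\<Sum>i=1..n. norm (z i))"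
proof -
  let ?K = "convex hull ((\<lambda>k. \<Sum>i=1..k. z i) ` {0..n})"
  have ne: "?K \<noteq> {}" by simp
  have int: "integrable unit_disc (\<lambda>x. \<bar>x \<bullet> v\<bar>)" for v
  proof -
    have "polytope (closed_segment 0 v)" by (simp add: segment_convex_hull polytope_convex_hull)
    then show ?thesis using integrable_width[of "closed_segment 0 v"] by (simp add: width_segment[abs_def])
  qed
  have w: "width ?K x \<le> (\<Sum>i=1..n. \<bar>x \<bullet> z i\<bar>)" for x
  proof -
    have *: "x \<bullet> (\<Sum>i=1..j. z i) - x \<bullet> (\<Sum>i=1..k. z i) \<le> (\<Sum>i=1..n. \<bar>x \<bullet> z i\<bar>)"
      if "j \<le> n" "k \<le> n" for j k
    proof -
      have pos: "x \<bullet> (\<Sum>i=1..j. z i) = (\<Sum>i=1..n. if i \<le> j then x \<bullet> z i else 0)" if "j \<le> n" for j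
      proof -
        have "{i \<in> {1..n}. i \<le> j} = {1..j}" using that by auto
        then show ?thesis
          by (simp only: inner_sum_right sum.inter_filter[OF finite_atLeastAtMost, symmetric])
      qed
      show ?thesis
        unfolding pos[OF \<open>j \<le> n\<close>] pos[OF \<open>k \<le> n\<close>] sum_subtractf[symmetric]
        by (intro sum_mono) auto
    qed
    show ?thesis
      by (rule width_hull_attained[where s="\<lambda>k. \<Sum>i=1..k. z i" and n=n and x=x]) (use * in simp)
  qed
  have "disc_abs_inner * perimeter ?K = 2 * (\<integral>x. width ?K x \<partial>unit_disc)"
    by (rule perimeter_eq_integral_width[OF polytope_hull_image ne])
  also have "(\<integral>x. width ?K x \<partial>unit_disc) \<le> (\<integral>x. (\<Sum>i=1..n. \<bar>x \<bullet> z i\<bar>) \<partial>unit_disc)"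
    using w int by (intro integral_mono integrable_width[OF polytope_hull_image ne] Bochner_Integration.integrable_sum) auto
  also have "\<dots> = disc_abs_inner * (\<Sum>i=1..n. norm (z i))"
    using int by (subst Bochner_Integration.integral_sum) (auto simp: integral_unit_disc_abs_inner sum_distrib_left)
  finally show ?thesis using disc_abs_inner_pos by (simp add: mult.left_commute)
qed

text \<open>
  The lower bound comes from the indices \<open>0\<close> and \<open>n\<close>. For the upper bound, all but finitely many terms
  satisfy \<open>a k < c * k\<close>, and the finitely many others are absorbed by dividing by \<open>n\<close>.
\<close>
lemma tendsto_Max_over_n:
  fixes a :: "nat \<Rightarrow> real"
  assumes a0: "a 0 = 0" and lim: "(\<lambda>n. a n / real n) \<longlonglongrightarrow> m"
  shows "(\<lambda>n. Max (a ` {0..n}) / real n) \<longlonglongrightarrow> max 0 m"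
proof (rule order_tendstoI)
  fix c assume c: "c < max 0 m"
  have "eventually (\<lambda>n. c < max 0 (a n / real n)) sequentially"
    using tendsto_max[OF tendsto_const lim] c by (rule order_tendstoD)
  then show "eventually (\<lambda>n. c < Max (a ` {0..n}) / real n) sequentially"
  proof eventually_elim
    case (elim n)
    have "0 \<le> Max (a ` {0..n})" "a n \<le> Max (a ` {0..n})"
      using a0 by (auto intro!: Max_ge image_eqI[of _ a 0])
    then have "max 0 (a n / real n) \<le> Max (a ` {0..n}) / real n"
      by (auto intro!: divide_right_mono)
    with elim show ?case by (rule less_le_trans)
  qed
next
  fix c assume c: "max 0 m < c"
  have "eventually (\<lambda>n. a n / real n < c) sequentially"
    using lim c by (intro order_tendstoD) auto
  then obtain N where N: "\<And>k. k \<ge> N \<Longrightarrow> a k / real k < c" by (auto simp: eventually_sequentially)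
  define B where "B = Max (a ` {0..N})"
  have B: "a k \<le> B" if "k \<le> N" for k unfolding B_def using that by (intro Max_ge) auto
  have "(\<lambda>n. B / real n) \<longlonglongrightarrow> 0" by (rule lim_const_over_n)
  then have "eventually (\<lambda>n. B / real n < c) sequentially"
    using c by (intro order_tendstoD) auto
  then show "eventually (\<lambda>n. Max (a ` {0..n}) / real n < c) sequentially"
    using eventually_gt_at_top[of 0]
  proof eventually_elim
    case (elim n)
    have "a k < c * real n" if "k \<le> n" for k
    proof (cases "k \<le> N")
      case True
      then show ?thesis using B[of k] elim by (simp add: pos_divide_less_eq)
    next
      case False
      then have "a k < c * real k" using N[of k] by (simp add: pos_divide_less_eq)
      also have "\<dots> \<le> c * real n" using that c by (intro mult_left_mono) auto
      finally show ?thesis .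
    qed
    then have "Max (a ` {0..n}) < c * real n" by simp
    then show ?case using elim by (simp add: pos_divide_less_eq)
  qed
qed

lemma tendsto_range_over_n:
  fixes a :: "nat \<Rightarrow> real"
  assumes a0: "a 0 = 0" and lim: "(\<lambda>n. a n / real n) \<longlonglongrightarrow> m"
  shows "(\<lambda>n. (Max (a ` {0..n}) - Min (a ` {0..n})) / real n) \<longlonglongrightarrow> \<bar>m\<bar>"
proof -
  have "(\<lambda>n. - a n / real n) \<longlonglongrightarrow> - m" using tendsto_minus[OF lim] by simp
  then have "(\<lambda>n. Max ((\<lambda>k. - a k) ` {0..n}) / real n) \<longlonglongrightarrow> max 0 (- m)"
    using a0 by (intro tendsto_Max_over_n) auto
  from tendsto_add[OF tendsto_Max_over_n[OF assms] this]
  have "(\<lambda>n. (Max (a ` {0..n}) + Max ((\<lambda>k. - a k) ` {0..n})) / real n) \<longlonglongrightarrow> max 0 m + max 0 (- m)"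
    by (simp add: add_divide_distrib)
  moreover have "Max ((\<lambda>k. - a k) ` {0..n}) = - Min (a ` {0..n})" for n
    using minus_Min_eq_Max[of "a ` {0..n}"] by (simp add: image_image del: minus_Min_eq_Max)
  moreover have "max 0 m + max 0 (- m) = \<bar>m\<bar>" by auto
  ultimately show ?thesis by (simp del: minus_Min_eq_Max)
qed

text \<open>
  Only the asymptotic velocity of the sequence matters: seen from far away the points \<open>s 0, \<dots>, s n\<close> lie
  along the segment from \<open>0\<close> to \<open>n *\<^sub>R \<mu>\<close>, whose degenerate perimeter is \<open>2 * n * norm \<mu>\<close>. In each
  direction the widths converge after division by \<open>n\<close>, with a bound that does not depend on \<open>n\<close>.
\<close>
lemma tendsto_perimeter_hull:
  fixes s :: "nat \<Rightarrow> real^2"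
  assumes s0: "s 0 = 0" and lim: "(\<lambda>n. s n /\<^sub>R real n) \<longlonglongrightarrow> \<mu>"
  shows "(\<lambda>n. perimeter (convex hull (s ` {0..n})) / real n) \<longlonglongrightarrow> 2 * norm \<mu>"
proof -
  let ?K = "\<lambda>n. convex hull (s ` {0..n})"
  interpret finite_measure unit_disc by (rule finite_measure_unit_disc)
  have ne: "?K n \<noteq> {}" for n by simp
  note int = integrable_width[OF polytope_hull_image ne]
  obtain B where B: "\<And>n. norm (s n /\<^sub>R real n) \<le> B"
    using convergent_imp_Bseq[of "\<lambda>n. s n /\<^sub>R real n"] lim by (auto simp: convergent_def Bseq_def)
  have sB: "norm (s k) \<le> B * real k" for k
    using B[of k] s0 by (cases "k = 0") (auto simp: field_simps)
  have B0: "B \<ge> 0" using B[of 0] by simp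
  have "(\<lambda>n. \<integral>x. width (?K n) x / real n \<partial>unit_disc) \<longlonglongrightarrow> (\<integral>x. \<bar>x \<bullet> \<mu>\<bar> \<partial>unit_disc)"
  proof (rule integral_dominated_convergence)
    show "(\<lambda>x. \<bar>x \<bullet> \<mu>\<bar>) \<in> borel_measurable unit_disc"
      by (intro measurable_restrict_space1) auto
    show "(\<lambda>x. width (?K n) x / real n) \<in> borel_measurable unit_disc" for n
      using int[of n] by (intro borel_measurable_divide borel_measurable_integrable) auto
    show "integrable unit_disc (\<lambda>_. 2 * B)" by simp
    show "AE x in unit_disc. (\<lambda>n. width (?K n) x / real n) \<longlonglongrightarrow> \<bar>x \<bullet> \<mu>\<bar>"
    proof (rule AE_I2)
      fix x :: "real^2"
      have "(\<lambda>n. x \<bullet> (s n /\<^sub>R real n)) \<longlonglongrightarrow> x \<bullet> \<mu>" by (intro tendsto_intros lim)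
      then have "(\<lambda>n. (x \<bullet> s n) / real n) \<longlonglongrightarrow> x \<bullet> \<mu>" by (simp add: divide_inverse mult.commute)
      then show "(\<lambda>n. width (?K n) x / real n) \<longlonglongrightarrow> \<bar>x \<bullet> \<mu>\<bar>"
        unfolding width_hull_image using s0 by (intro tendsto_range_over_n) auto
    qed
    show "AE x in unit_disc. norm (width (?K n) x / real n) \<le> 2 * B" for n
    proof (rule AE_I2)
      fix x assume "x \<in> space unit_disc"
      then have x: "norm x \<le> 1" by (simp add: space_unit_disc)
      have ip: "\<bar>x \<bullet> s k\<bar> \<le> B * real n" if "k \<le> n" for k
      proof -
        have "\<bar>x \<bullet> s k\<bar> \<le> norm x * norm (s k)" by (rule Cauchy_Schwarz_ineq2)
        also have "\<dots> \<le> 1 * (B * real k)" using x sB[of k] by (intro mult_mono) auto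
        also have "\<dots> \<le> B * real n" using that B0 by (simp add: mult_left_mono)
        finally show ?thesis .
      qed
      obtain i j where "i \<le> n" "j \<le> n" "width (?K n) x = x \<bullet> s i - x \<bullet> s j"
        by (rule width_hull_attained)
      with ip[of i] ip[of j] have "\<bar>width (?K n) x\<bar> \<le> 2 * B * real n" by linarith
      then show "norm (width (?K n) x / real n) \<le> 2 * B"
        using B0 by (cases "n = 0") (auto simp: pos_divide_le_eq)
    qed
  qed
  then have "(\<lambda>n. 2 / disc_abs_inner * (\<integral>x. width (?K n) x / real n \<partial>unit_disc))
      \<longlonglongrightarrow> 2 / disc_abs_inner * (disc_abs_inner * norm \<mu>)"
    unfolding integral_unit_disc_abs_inner by (intro tendsto_intros)
  moreover have "2 / disc_abs_inner * (\<integral>x. width (?K n) x / real n \<partial>unit_disc) = perimeter (?K n) / real n" for n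
    by (simp add: perimeter_eq[OF polytope_hull_image ne])
  ultimately show ?thesis using disc_abs_inner_pos by simp
qed

section \<open>Independent and identically distributed families\<close>

lemma (in prob_space) indep_vars_reindex:
  assumes X: "indep_vars N X I" and f: "inj_on f J" "f ` J \<subseteq> I"
  shows "indep_vars (\<lambda>j. N (f j)) (\<lambda>j. X (f j)) J"
proof -
  let ?F = "\<lambda>i. {X i -` A \<inter> space M |A. A \<in> sets (N i)}"
  have F: "indep_sets ?F I" using X by (simp add: indep_vars_def2)
  have "indep_sets (\<lambda>j. ?F (f j)) J"
  proof (rule indep_setsI)
    show "?F (f j) \<subseteq> events" if "j \<in> J" for j
      using F f that by (auto simp: indep_sets_def)
    fix A K assume K: "K \<noteq> {}" "K \<subseteq> J" "finite K" "\<forall>j\<in>K. A j \<in> ?F (f j)"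
    define B where "B i = A (the_inv_into K f i)" for i
    have inj: "inj_on f K" using f K inj_on_subset by blast
    have B: "B (f j) = A j" if "j \<in> K" for j
      using that inj by (simp add: B_def the_inv_into_f_f)
    have "prob (\<Inter>i\<in>f ` K. B i) = (\<Prod>i\<in>f ` K. prob (B i))"
    proof (rule indep_setsD[OF F])
      show "f ` K \<subseteq> I" using K(2) f(2) by blast
      show "\<forall>i\<in>f ` K. B i \<in> ?F i" using K(4) B by simp
    qed (use K in auto)
    then show "prob (\<Inter>j\<in>K. A j) = (\<Prod>j\<in>K. prob (A j))"
      using B by (simp add: prod.reindex[OF inj])
  qed
  then show ?thesis using X f by (auto simp: indep_vars_def2)
qed

lemma (in prob_space) ident_distr_integrable:
  fixes X :: "nat \<Rightarrow> 'a \<Rightarrow> 'b::{banach, second_countable_topology}"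
  assumes "\<And>i. X i \<in> borel_measurable M" "\<And>i. distr M borel (X i) = distr M borel (X 0)"
    and "integrable M (X 0)"
  shows "integrable M (X i)" "expectation (X i) = expectation (X 0)"
proof -
  have "integrable (distr M borel (X j)) (\<lambda>x. x) \<longleftrightarrow> integrable M (X j)" for j
    using assms(1) by (subst integrable_distr_eq) auto
  then show "integrable M (X i)" using assms(2,3) by metis
  have "integral\<^sup>L (distr M borel (X j)) (\<lambda>x. x) = expectation (X j)" for j
    using assms(1) by (subst integral_distr) auto
  then show "expectation (X i) = expectation (X 0)" using assms(2) by metis
qed

text \<open>
  The second Borel--Cantelli lemma. The event \<open>E n\<close> that nothing happens from time \<open>n\<close> on has probability
  at most \<open>\<Prod>(1 - p m) \<le> exp (- (\<Sum>p m))\<close> over any finite stretch of times, and the sum is unbounded.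
\<close>
lemma (in prob_space) borel_cantelli_indep_vars:
  assumes indep: "indep_vars N X UNIV" and A: "\<And>m::nat. A m \<in> sets (N m)"
    and nsum: "\<not> summable (\<lambda>m. prob {\<omega>\<in>space M. X m \<omega> \<in> A m})"
  shows "AE \<omega> in M. \<exists>\<^sub>\<infinity>m. X m \<omega> \<in> A m"
proof -
  have rv[measurable]: "X m \<in> measurable M (N m)" for m using indep by (simp add: indep_vars_def2)
  note A[measurable]
  define p where "p m = prob {\<omega>\<in>space M. X m \<omega> \<in> A m}" for m
  define E where "E n = {\<omega>\<in>space M. \<forall>m\<ge>n. X m \<omega> \<notin> A m}" for n
  have [measurable]: "E n \<in> events" for n unfolding E_def by measurable
  have le: "prob (E n) \<le> exp (- (\<Sum>m=n..<n+k. p m))" for n k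
  proof (cases "k = 0")
    case False
    have "prob (E n) \<le> prob (\<Inter>m\<in>{n..<n+k}. X m -` (space (N m) - A m) \<inter> space M)"
    proof (intro finite_measure_mono)
      show "E n \<subseteq> (\<Inter>m\<in>{n..<n+k}. X m -` (space (N m) - A m) \<inter> space M)"
        by (auto simp: E_def intro: measurable_space[OF rv])
      show "(\<Inter>m\<in>{n..<n+k}. X m -` (space (N m) - A m) \<inter> space M) \<in> events"
        using False by (intro sets.finite_INT measurable_sets[OF rv]) (auto simp: A)
    qed
    also have "\<dots> = (\<Prod>m\<in>{n..<n+k}. prob (X m -` (space (N m) - A m) \<inter> space M))"
      using False by (intro indep_varsD[OF indep]) (auto simp: A)
    also have "\<dots> \<le> (\<Prod>m\<in>{n..<n+k}. exp (- p m))"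
    proof (intro prod_mono conjI)
      fix m
      have "X m -` (space (N m) - A m) \<inter> space M = space M - {\<omega>\<in>space M. X m \<omega> \<in> A m}"
        using measurable_space[OF rv] by auto
      then have "prob (X m -` (space (N m) - A m) \<inter> space M) = 1 - p m"
        unfolding p_def by (subst prob_compl[symmetric]) auto
      also have "\<dots> \<le> exp (- p m)" using exp_ge_add_one_self[of "- p m"] by simp
      finally show "prob (X m -` (space (N m) - A m) \<inter> space M) \<le> exp (- p m)" .
    qed simp
    finally show ?thesis by (simp add: exp_sum sum_negf[symmetric])
  qed simp
  have "prob (E n) = 0" for n
  proof -
    have "\<not> summable (\<lambda>m. p (m + n))" using nsum unfolding p_def[symmetric] summable_iff_shift .
    then have unb: "\<not> (\<exists>B. \<forall>k. (\<Sum>m<k. p (m + n)) \<le> B)"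
      using bounded_imp_summable[of "\<lambda>m. p (m + n)"] summableI_nonneg_bounded[of "\<lambda>m. p (m + n)"]
      by (auto simp: p_def)
    have sh: "(\<Sum>m=n..<n+k. p m) = (\<Sum>m<k. p (m + n))" for k
      using sum.shift_bounds_nat_ivl[of p 0 n k] by (simp add: add.commute lessThan_atLeast0)
    show ?thesis
    proof (rule ccontr)
      assume "prob (E n) \<noteq> 0"
      then have pos: "prob (E n) > 0" by (simp add: zero_less_measure_iff)
      have "(\<Sum>m<k. p (m + n)) \<le> - ln (prob (E n))" for k
        using le[of n k] pos unfolding sh by (metis exp_gt_zero ln_exp ln_le_cancel_iff le_minus_iff)
      with unb show False by blast
    qed
  qed
  then have "AE \<omega> in M. \<omega> \<notin> E n" for n by (simp add: prob_eq_0)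
  then have "AE \<omega> in M. \<forall>n. \<omega> \<notin> E n" by (simp add: AE_all_countable)
  then show ?thesis
    using AE_space by eventually_elim (auto simp: E_def INFM_nat_le)
qed

text \<open>
  A number \<open>y \<ge> 0\<close> is at most the number of \<open>m\<close> with \<open>m \<le> y\<close>, as \<open>m = 0\<close> is counted too.
\<close>
lemma (in prob_space) nn_integral_finite_of_summable_tails:
  assumes Y[measurable]: "Y \<in> borel_measurable M"
    and sum: "summable (\<lambda>m. prob {\<omega>\<in>space M. real m \<le> Y \<omega>})"
  shows "(\<integral>\<^sup>+\<omega>. ennreal (Y \<omega>) \<partial>M) < \<infinity>"
proof -
  have pw: "ennreal y \<le> (\<Sum>m. indicator {m. real m \<le> y} m)" for y
  proof (cases "y \<ge> 0")
    case True
    define N where "N = Suc (nat \<lfloor>y\<rfloor>)"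
    have "real m \<le> y" if "m < N" for m using that True unfolding N_def by linarith
    then have "(\<Sum>m<N. indicator {m. real m \<le> y} m) = (of_nat N :: ennreal)" by (simp add: indicator_def)
    moreover have "ennreal y \<le> of_nat N"
      unfolding ennreal_of_nat_eq_real_of_nat N_def by (intro ennreal_leI) (use True in linarith)
    moreover have "(\<Sum>m<N. indicator {m. real m \<le> y} m) \<le> (\<Sum>m. indicator {m. real m \<le> y} m :: ennreal)"
      by (intro sum_le_suminf) auto
    ultimately show ?thesis by (metis order_trans)
  qed (simp add: ennreal_neg)
  have "(\<integral>\<^sup>+\<omega>. ennreal (Y \<omega>) \<partial>M) \<le> (\<integral>\<^sup>+\<omega>. (\<Sum>m. indicator {\<omega>\<in>space M. real m \<le> Y \<omega>} \<omega>) \<partial>M)"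
  proof (rule nn_integral_mono)
    fix \<omega> assume "\<omega> \<in> space M"
    then show "ennreal (Y \<omega>) \<le> (\<Sum>m. indicator {\<omega>\<in>space M. real m \<le> Y \<omega>} \<omega>)"
      using pw[of "Y \<omega>"] by (simp add: indicator_def)
  qed
  also have "\<dots> = (\<Sum>m. \<integral>\<^sup>+\<omega>. indicator {\<omega>\<in>space M. real m \<le> Y \<omega>} \<omega> \<partial>M)"
    by (rule nn_integral_suminf) measurable
  also have "\<dots> = (\<Sum>m. ennreal (prob {\<omega>\<in>space M. real m \<le> Y \<omega>}))"
    by (simp add: emeasure_eq_measure)
  also have "\<dots> = ennreal (\<Sum>m. prob {\<omega>\<in>space M. real m \<le> Y \<omega>})"
    using sum by (intro suminf_ennreal2) auto
  finally show ?thesis by (rule le_less_trans) simp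
qed

section \<open>The strong law of large numbers\<close>

definition run_max :: "nat \<Rightarrow> (nat \<Rightarrow> real) \<Rightarrow> real" where
  "run_max n x = Max ((\<lambda>k. \<Sum>i<k. x i) ` {..n})"

text \<open>
  A walk of \<open>n + 1\<close> steps either has its maximum at time zero or makes its first step and continues with
  the walk of the remaining \<open>n\<close> steps (Lindley's recursion).
\<close>
lemma run_max_Suc: "run_max (Suc n) x = max 0 (x 0 + run_max n (\<lambda>i. x (Suc i)))"
proof -
  have "run_max (Suc n) x = max 0 (Max ((\<lambda>k. (\<Sum>i<k. x (Suc i)) + x 0) ` {..n}))"
    by (simp add: run_max_def atMost_Suc_eq_insert_0 image_image sum.lessThan_Suc_shift add.commute del: sum.lessThan_Suc)
  also have "Max ((\<lambda>k. (\<Sum>i<k. x (Suc i)) + x 0) ` {..n}) = run_max n (\<lambda>i. x (Suc i)) + x 0"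
    unfolding run_max_def by (rule Max_add_commute) auto
  finally show ?thesis by (simp add: add.commute)
qed

lemma run_max_ge: "k \<le> n \<Longrightarrow> (\<Sum>i<k. x i) \<le> run_max n x"
  unfolding run_max_def by (rule Max_ge) auto

lemma run_max_nonneg: "0 \<le> run_max n x"
  using run_max_ge[of 0 n x] by simp

lemma run_max_le_sum_abs: "run_max n x \<le> (\<Sum>i\<le>n. \<bar>x i\<bar>)"
proof -
  have "(\<Sum>i<k. x i) \<le> (\<Sum>i\<le>n. \<bar>x i\<bar>)" if "k \<le> n" for k
  proof -
    have "(\<Sum>i<k. x i) \<le> (\<Sum>i<k. \<bar>x i\<bar>)" by (intro sum_mono) auto
    also have "\<dots> \<le> (\<Sum>i\<le>n. \<bar>x i\<bar>)" using that by (intro sum_mono2) auto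
    finally show ?thesis .
  qed
  then show ?thesis by (simp add: run_max_def)
qed

lemma run_max_cong: "(\<And>i. i \<le> n \<Longrightarrow> x i = y i) \<Longrightarrow> run_max n x = run_max n y"
  unfolding run_max_def by (intro arg_cong[of _ _ Max] image_cong sum.cong) auto

lemma borel_measurable_run_max:
  assumes "\<And>i. i \<le> n \<Longrightarrow> (\<lambda>\<omega>. X i \<omega>) \<in> borel_measurable M"
  shows "(\<lambda>\<omega>. run_max n (\<lambda>i. X i \<omega>)) \<in> borel_measurable M"
  unfolding run_max_def using assms by (intro borel_measurable_Max borel_measurable_sum) auto

lemma bdd_above_partial_sums_shift:
  fixes x :: "nat \<Rightarrow> real"
  shows "bdd_above (range (\<lambda>n. \<Sum>i<n. x i)) \<longleftrightarrow> bdd_above (range (\<lambda>n. \<Sum>i<n. x (j + i)))"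
proof (induction j)
  case (Suc j)
  have step: "bdd_above (range (\<lambda>n. \<Sum>i<n. y i)) \<longleftrightarrow> bdd_above (range (\<lambda>n. \<Sum>i<n. y (Suc i)))"
    for y :: "nat \<Rightarrow> real"
  proof -
    have "range (\<lambda>n. \<Sum>i<n. y i) = insert 0 ((\<lambda>s. y 0 + s) ` range (\<lambda>n. \<Sum>i<n. y (Suc i)))"
      by (subst UNIV_nat_eq)
        (simp add: image_image sum.lessThan_Suc_shift del: sum.lessThan_Suc)
    then have "bdd_above (range (\<lambda>n. \<Sum>i<n. y i))
      \<longleftrightarrow> bdd_above ((\<lambda>s. y 0 + s) ` range (\<lambda>n. \<Sum>i<n. y (Suc i)))" by simp
    also have "\<dots> \<longleftrightarrow> bdd_above (range (\<lambda>n. \<Sum>i<n. y (Suc i)))"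
      unfolding bdd_above_def by (auto simp: le_diff_eq[symmetric] add.commute intro: exI[of _ "_ + y 0"])
        (metis add_le_cancel_left diff_add_cancel add.commute)+
    finally show ?thesis .
  qed
  show ?case using Suc step[of "\<lambda>i. x (j + i)"] by simp
qed simp

lemma not_bdd_above_rangeD:
  fixes f :: "'b \<Rightarrow> 'c::linorder"
  assumes "\<not> bdd_above (range f)"
  shows "\<exists>n. c < f n"
proof (rule ccontr)
  assume "\<not> ?thesis"
  then have "bdd_above (range f)" by (intro bdd_aboveI2[of _ _ c]) (simp add: not_less)
  with assms show False by blast
qed

text \<open>
  Dropping finitely many steps does not affect whether the partial sums are bounded above, so this is a
  tail event and Kolmogorov's zero-one law applies.
\<close>
lemma (in prob_space) prob_unbounded_partial_sums_0_1:
  fixes X :: "nat \<Rightarrow> 'a \<Rightarrow> real"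
  assumes indep: "indep_vars (\<lambda>_. borel) X UNIV"
  shows "(AE \<omega> in M. bdd_above (range (\<lambda>n. \<Sum>i<n. X i \<omega>)))
    \<or> (AE \<omega> in M. \<not> bdd_above (range (\<lambda>n. \<Sum>i<n. X i \<omega>)))"
proof -
  have rv[measurable]: "X i \<in> borel_measurable M" for i using indep by (simp add: indep_vars_def2)
  define A where "A i = sigma_sets (space M) {X i -` B \<inter> space M | B. B \<in> sets borel}" for i
  define U where "U = {\<omega>\<in>space M. \<not> bdd_above (range (\<lambda>n. \<Sum>i<n. X i \<omega>))}"
  have "U \<in> sigma_sets (space M) (\<Union> (A ` {j..}))" for j
  proof -
    define N where "N = sigma (space M) (\<Union> (A ` {j..}))"
    have AP: "\<Union> (A ` {j..}) \<subseteq> Pow (space M)"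
      unfolding A_def by (auto dest: sigma_sets_into_sp[rotated])
    have spN: "space N = space M" by (simp add: N_def space_measure_of_conv)
    have seN: "sets N = sigma_sets (space M) (\<Union> (A ` {j..}))" using AP by (simp add: N_def)
    have [measurable]: "(\<lambda>\<omega>. X (j + i) \<omega>) \<in> borel_measurable N" for i
    proof (rule measurableI)
      fix B :: "real set" assume "B \<in> sets borel"
      then have "X (j + i) -` B \<inter> space M \<in> A (j + i)" by (auto simp: A_def)
      then show "(\<lambda>\<omega>. X (j + i) \<omega>) -` B \<inter> space N \<in> sets N"
        unfolding spN seN by (intro sigma_sets.Basic) auto
    qed simp
    \<comment> \<open>Countably many conditions on the steps from time \<open>j\<close> on, whence measurability in \<open>N\<close>.\<close>
    have "U = {\<omega>\<in>space N. \<forall>b::nat. \<exists>n. (\<Sum>i<n. X (j + i) \<omega>) > real b}"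
    proof -
      have "\<not> bdd_above (range f) \<longleftrightarrow> (\<forall>b::nat. \<exists>n. f n > real b)" for f :: "nat \<Rightarrow> real"
      proof
        assume unb: "\<not> bdd_above (range f)"
        show "\<forall>b::nat. \<exists>n. f n > real b"
          using not_bdd_above_rangeD[OF unb] by blast
      next
        assume *: "\<forall>b::nat. \<exists>n. f n > real b"
        show "\<not> bdd_above (range f)"
        proof
          assume "bdd_above (range f)"
          then obtain c where c: "f n \<le> c" for n by (auto simp: bdd_above_def)
          obtain b :: nat where "c \<le> real b" using real_arch_simple by blast
          with c * show False by (meson order_trans linorder_not_le)
        qed
      qed
      then show ?thesis
        unfolding U_def spN bdd_above_partial_sums_shift[of "\<lambda>i. X i _" j] by simp
    qed
    also have "\<dots> \<in> sets N" by measurable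
    finally show ?thesis by (simp add: seN)
  qed
  then have tail: "U \<in> tail_events A" by (simp add: tail_events_def)
  have A: "sigma_algebra (space M) (A i)" for i
    unfolding A_def by (intro sigma_algebra_sigma_sets) auto
  have ind: "indep_sets A UNIV" using indep unfolding indep_vars_def A_def[abs_def] by blast
  have U: "U \<in> events"
    using tail_events_sets[of A] tail A ind by (auto simp: indep_sets_def)
  have "prob U = 0 \<or> prob U = 1" by (rule kolmogorov_0_1_law[OF A ind tail])
  then show ?thesis
  proof
    assume "prob U = 0"
    then have "AE \<omega> in M. \<omega> \<notin> U" using U by (simp add: prob_eq_0)
    then show ?thesis unfolding U_def by (intro disjI1) (auto elim!: AE_mp)
  next
    assume "prob U = 1"
    then have "AE \<omega> in M. \<omega> \<in> U" using U by (simp add: prob_eq_1)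
    then show ?thesis unfolding U_def by (intro disjI2) (auto elim!: AE_mp)
  qed
qed

text \<open>
  The running maximum is a function of the joint law of the first steps, and this law is the same
  product measure for the shifted sequence.
\<close>
lemma (in prob_space) expectation_run_max_shift:
  fixes X :: "nat \<Rightarrow> 'a \<Rightarrow> real"
  assumes indep: "indep_vars (\<lambda>_. borel) X UNIV"
    and ident: "\<And>i. distr M borel (X i) = distr M borel (X 0)"
  shows "expectation (\<lambda>\<omega>. run_max n (\<lambda>i. X (Suc i) \<omega>)) = expectation (\<lambda>\<omega>. run_max n (\<lambda>i. X i \<omega>))"
proof -
  have *: "expectation (\<lambda>\<omega>. run_max n (\<lambda>i. Y i \<omega>))
      = integral\<^sup>L (\<Pi>\<^sub>M i\<in>{..n}. distr M borel (X 0)) (run_max n)"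
    if Y: "indep_vars (\<lambda>_. borel) Y UNIV" and YX: "\<And>i. distr M borel (Y i) = distr M borel (X 0)"
    for Y :: "nat \<Rightarrow> 'a \<Rightarrow> real"
  proof -
    have rv[measurable]: "Y i \<in> borel_measurable M" for i using Y by (simp add: indep_vars_def2)
    have "distr M (\<Pi>\<^sub>M i\<in>{..n}. borel) (\<lambda>x. \<lambda>i\<in>{..n}. Y i x) = (\<Pi>\<^sub>M i\<in>{..n}. distr M borel (Y i))"
      using indep_vars_subset[OF Y, of "{..n}"] indep_vars_iff_distr_eq_PiM[of "{..n}" Y "\<lambda>_. borel"]
      by auto
    then have d: "(\<Pi>\<^sub>M i\<in>{..n}. distr M borel (X 0)) = distr M (\<Pi>\<^sub>M i\<in>{..n}. borel) (\<lambda>x. \<lambda>i\<in>{..n}. Y i x)"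
      by (simp add: YX)
    have "run_max n \<in> borel_measurable (\<Pi>\<^sub>M i\<in>{..n}. borel)"
      using borel_measurable_run_max[of n "\<lambda>i x. x i" "\<Pi>\<^sub>M i\<in>{..n}. borel"] by simp
    then have "integral\<^sup>L (\<Pi>\<^sub>M i\<in>{..n}. distr M borel (X 0)) (run_max n)
        = expectation (\<lambda>\<omega>. run_max n (\<lambda>i\<in>{..n}. Y i \<omega>))"
      unfolding d by (intro integral_distr) measurable
    also have "\<dots> = expectation (\<lambda>\<omega>. run_max n (\<lambda>i. Y i \<omega>))"
      by (intro Bochner_Integration.integral_cong run_max_cong) auto
    finally show ?thesis by simp
  qed
  have "indep_vars (\<lambda>_. borel) (\<lambda>i. X (Suc i)) UNIV"
    using indep_vars_reindex[OF indep, of Suc UNIV] by simp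
  then show ?thesis using *[OF indep ident] *[of "\<lambda>i. X (Suc i)"] ident by simp
qed

text \<open>
  Otherwise the partial sums are unbounded above almost surely, by the zero-one law. Let \<open>R n\<close> be the
  running maximum of the walk without its first step. By the recursion, \<open>max (- R n) (X 0)\<close> is the
  running maximum of \<open>n + 1\<close> steps minus \<open>R n\<close>. Its mean is nonnegative, because \<open>R n\<close> has the same mean as
  the running maximum of \<open>n\<close> steps. But \<open>R n\<close> tends to infinity, so \<open>max (- R n) (X 0)\<close> tends to \<open>X 0\<close>
  and is dominated by \<open>\<bar>X 0\<bar>\<close>; hence \<open>X 0\<close> has nonnegative mean.
\<close>
lemma (in prob_space) iid_negative_mean_bdd_above:
  fixes X :: "nat \<Rightarrow> 'a \<Rightarrow> real"
  assumes indep: "indep_vars (\<lambda>_. borel) X UNIV"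
    and ident: "\<And>i. distr M borel (X i) = distr M borel (X 0)"
    and int: "integrable M (X 0)" and neg: "expectation (X 0) < 0"
  shows "AE \<omega> in M. bdd_above (range (\<lambda>n. \<Sum>i<n. X i \<omega>))"
proof (rule ccontr)
  assume "\<not> ?thesis"
  then have unb: "AE \<omega> in M. \<not> bdd_above (range (\<lambda>n. \<Sum>i<n. X i \<omega>))"
    using prob_unbounded_partial_sums_0_1[OF indep] by blast
  have rv[measurable]: "X i \<in> borel_measurable M" for i using indep by (simp add: indep_vars_def2)
  have intX: "integrable M (X i)" for i using ident_distr_integrable(1)[of X, OF rv ident int] .
  have mint: "integrable M (\<lambda>\<omega>. run_max n (\<lambda>i. X (f i) \<omega>))" for n f
  proof (rule Bochner_Integration.integrable_bound)
    show "integrable M (\<lambda>\<omega>. \<Sum>i\<le>n. \<bar>X (f i) \<omega>\<bar>)" using intX by auto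
    show "(\<lambda>\<omega>. run_max n (\<lambda>i. X (f i) \<omega>)) \<in> borel_measurable M"
      by (intro borel_measurable_run_max) auto
    show "AE \<omega> in M. norm (run_max n (\<lambda>i. X (f i) \<omega>)) \<le> norm (\<Sum>i\<le>n. \<bar>X (f i) \<omega>\<bar>)"
      using run_max_le_sum_abs[of n] run_max_nonneg[of n] by (intro AE_I2) (simp add: abs_of_nonneg sum_nonneg)
  qed
  define R where "R n \<omega> = run_max n (\<lambda>i. X (Suc i) \<omega>)" for n \<omega>
  have Rm[measurable]: "R n \<in> borel_measurable M" for n
    unfolding R_def by (intro borel_measurable_run_max) auto
  have R0: "R n \<omega> \<ge> 0" for n \<omega> unfolding R_def by (rule run_max_nonneg)
  have diff: "max (- R n \<omega>) (X 0 \<omega>) = run_max (Suc n) (\<lambda>i. X i \<omega>) - R n \<omega>" for n \<omega>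
    by (simp add: run_max_Suc R_def max_def)
  have "expectation (\<lambda>\<omega>. max (- R n \<omega>) (X 0 \<omega>)) \<ge> 0" for n
  proof -
    have "expectation (R n) = expectation (\<lambda>\<omega>. run_max n (\<lambda>i. X i \<omega>))"
      unfolding R_def by (rule expectation_run_max_shift[OF indep ident])
    also have "\<dots> \<le> expectation (\<lambda>\<omega>. run_max (Suc n) (\<lambda>i. X i \<omega>))"
      using mint[of _ "\<lambda>i. i"]
      by (intro integral_mono) (auto simp: run_max_def intro!: Max_mono)
    finally show ?thesis
      unfolding diff using mint[of "Suc n" "\<lambda>i. i"] mint[of n Suc] by (simp add: R_def[abs_def])
  qed
  moreover have "(\<lambda>n. expectation (\<lambda>\<omega>. max (- R n \<omega>) (X 0 \<omega>))) \<longlonglongrightarrow> expectation (X 0)"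
  proof (rule integral_dominated_convergence)
    show "integrable M (\<lambda>\<omega>. \<bar>X 0 \<omega>\<bar>)" using int by simp
    show "AE \<omega> in M. norm (max (- R n \<omega>) (X 0 \<omega>)) \<le> \<bar>X 0 \<omega>\<bar>" for n
    proof (rule AE_I2)
      fix \<omega> show "norm (max (- R n \<omega>) (X 0 \<omega>)) \<le> \<bar>X 0 \<omega>\<bar>"
        using R0[of n \<omega>] by (simp add: max_def abs_if)
    qed
    show "AE \<omega> in M. (\<lambda>n. max (- R n \<omega>) (X 0 \<omega>)) \<longlonglongrightarrow> X 0 \<omega>"
      using unb
    proof eventually_elim
      case (elim \<omega>)
      then have "\<not> bdd_above (range (\<lambda>n. \<Sum>i<n. X (Suc i) \<omega>))"
        using bdd_above_partial_sums_shift[of "\<lambda>i. X i \<omega>" 1] by simp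
      from not_bdd_above_rangeD[OF this, of "- X 0 \<omega>"]
      obtain k where k: "(\<Sum>i<k. X (Suc i) \<omega>) > - X 0 \<omega>" by blast
      have "max (- R n \<omega>) (X 0 \<omega>) = X 0 \<omega>" if "n \<ge> k" for n
        using run_max_ge[OF that, of "\<lambda>i. X (Suc i) \<omega>"] k by (simp add: R_def)
      then show ?case
        by (intro tendsto_eventually) (auto simp: eventually_sequentially)
    qed
  qed auto
  ultimately have "expectation (X 0) \<ge> 0"
    by (intro LIMSEQ_le_const) auto
  with neg show False by simp
qed

text \<open>
  Subtracting a level \<open>d\<close> between the mean and \<open>c\<close> makes the mean of the steps negative. The partial sums
  of \<open>X i - d\<close> are then bounded above, and the bound disappears after division by \<open>n\<close>.
\<close>
lemma (in prob_space) iid_averages_eventually_less: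
  fixes X :: "nat \<Rightarrow> 'a \<Rightarrow> real"
  assumes indep: "indep_vars (\<lambda>_. borel) X UNIV"
    and ident: "\<And>i. distr M borel (X i) = distr M borel (X 0)"
    and int: "integrable M (X 0)" and c: "expectation (X 0) < c"
  shows "AE \<omega> in M. eventually (\<lambda>n. (\<Sum>i<n. X i \<omega>) / real n < c) sequentially"
proof -
  obtain d where d: "expectation (X 0) < d" "d < c" using c dense by blast
  have rv[measurable]: "X i \<in> borel_measurable M" for i using indep by (simp add: indep_vars_def2)
  have "AE \<omega> in M. bdd_above (range (\<lambda>n. \<Sum>i<n. X i \<omega> - d))"
  proof (rule iid_negative_mean_bdd_above)
    show "indep_vars (\<lambda>_. borel) (\<lambda>i \<omega>. X i \<omega> - d) UNIV"
      using indep by (rule indep_vars_compose2) auto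
    have "distr M borel (\<lambda>\<omega>. X i \<omega> - d) = distr (distr M borel (X i)) borel (\<lambda>x. x - d)" for i
      by (subst distr_distr) (auto simp: comp_def)
    then show "distr M borel (\<lambda>\<omega>. X i \<omega> - d) = distr M borel (\<lambda>\<omega>. X 0 \<omega> - d)" for i
      using ident by metis
  qed (use int d in \<open>auto simp: prob_space\<close>)
  then show ?thesis
  proof eventually_elim
    case (elim \<omega>)
    then obtain b where b: "(\<Sum>i<n. X i \<omega> - d) \<le> b" for n by (auto simp: bdd_above_def)
    have "(\<lambda>n. b / real n) \<longlonglongrightarrow> 0" by (rule lim_const_over_n)
    then have "eventually (\<lambda>n. b / real n < c - d) sequentially"
      using d by (intro order_tendstoD) auto
    then show ?case using eventually_gt_at_top[of 0]
    proof eventually_elim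
      case (elim n)
      have "(\<Sum>i<n. X i \<omega>) \<le> b + real n * d" using b[of n] by (simp add: sum_subtractf)
      then have "(\<Sum>i<n. X i \<omega>) / real n \<le> b / real n + d"
        using elim by (simp add: field_simps)
      with elim show ?case by simp
    qed
  qed
qed

lemma (in prob_space) strong_law_real:
  fixes X :: "nat \<Rightarrow> 'a \<Rightarrow> real"
  assumes indep: "indep_vars (\<lambda>_. borel) X UNIV"
    and ident: "\<And>i. distr M borel (X i) = distr M borel (X 0)"
    and int: "integrable M (X 0)"
  shows "AE \<omega> in M. (\<lambda>n. (\<Sum>i<n. X i \<omega>) / real n) \<longlonglongrightarrow> expectation (X 0)"
proof -
  have rv[measurable]: "X i \<in> borel_measurable M" for i using indep by (simp add: indep_vars_def2)
  let ?m = "expectation (X 0)"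
  let ?e = "\<lambda>k::nat. 1 / real (Suc k)"
  have "distr M borel (\<lambda>\<omega>. - X i \<omega>) = distr (distr M borel (X i)) borel uminus" for i
    by (subst distr_distr) (auto simp: comp_def)
  then have identm: "distr M borel (\<lambda>\<omega>. - X i \<omega>) = distr M borel (\<lambda>\<omega>. - X 0 \<omega>)" for i
    using ident by metis
  have indepm: "indep_vars (\<lambda>_. borel) (\<lambda>i \<omega>. - X i \<omega>) UNIV"
    using indep by (rule indep_vars_compose2) auto
  have "AE \<omega> in M. \<forall>k. eventually (\<lambda>n. (\<Sum>i<n. X i \<omega>) / real n < ?m + ?e k) sequentially"
    unfolding AE_all_countable
    by (intro allI iid_averages_eventually_less[OF indep ident int]) auto
  moreover have "AE \<omega> in M. \<forall>k. eventually (\<lambda>n. (\<Sum>i<n. - X i \<omega>) / real n < - ?m + ?e k) sequentially"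
    unfolding AE_all_countable
    by (intro allI iid_averages_eventually_less[OF indepm identm]) (use int in auto)
  ultimately show ?thesis
  proof eventually_elim
    case (elim \<omega>)
    show ?case
    proof (rule LIMSEQ_I)
      fix r :: real assume "r > 0"
      then obtain k where k: "?e k < r" using nat_approx_posE by blast
      from elim have "eventually (\<lambda>n. (\<Sum>i<n. X i \<omega>) / real n < ?m + ?e k
          \<and> (\<Sum>i<n. - X i \<omega>) / real n < - ?m + ?e k) sequentially"
        by (intro eventually_conj) auto
      then have "eventually (\<lambda>n. norm ((\<Sum>i<n. X i \<omega>) / real n - ?m) < r) sequentially"
      proof eventually_elim
        case (elim n)
        then show ?case using k by (simp add: sum_negf abs_less_iff)
      qed
      then show "\<exists>n0. \<forall>n\<ge>n0. norm ((\<Sum>i<n. X i \<omega>) / real n - ?m) < r"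
        by (simp add: eventually_sequentially)
    qed
  qed
qed

lemma (in prob_space) strong_law:
  fixes X :: "nat \<Rightarrow> 'a \<Rightarrow> 'b::euclidean_space"
  assumes indep: "indep_vars (\<lambda>_. borel) X UNIV"
    and ident: "\<And>i. distr M borel (X i) = distr M borel (X 0)"
    and int: "integrable M (X 0)"
  shows "AE \<omega> in M. (\<lambda>n. (\<Sum>i<n. X i \<omega>) /\<^sub>R real n) \<longlonglongrightarrow> expectation (X 0)"
proof -
  have rv[measurable]: "X i \<in> borel_measurable M" for i using indep by (simp add: indep_vars_def2)
  have "AE \<omega> in M. (\<lambda>n. (\<Sum>i<n. X i \<omega> \<bullet> b) / real n) \<longlonglongrightarrow> expectation (X 0) \<bullet> b"
    for b :: 'b
  proof -
    have "AE \<omega> in M. (\<lambda>n. (\<Sum>i<n. X i \<omega> \<bullet> b) / real n) \<longlonglongrightarrow> expectation (\<lambda>\<omega>. X 0 \<omega> \<bullet> b)"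
    proof (rule strong_law_real)
      show "indep_vars (\<lambda>_. borel) (\<lambda>i \<omega>. X i \<omega> \<bullet> b) UNIV"
        using indep by (rule indep_vars_compose2) auto
      have "distr M borel (\<lambda>\<omega>. X i \<omega> \<bullet> b) = distr (distr M borel (X i)) borel (\<lambda>x. x \<bullet> b)" for i
        by (subst distr_distr) (auto simp: comp_def)
      then show "distr M borel (\<lambda>\<omega>. X i \<omega> \<bullet> b) = distr M borel (\<lambda>\<omega>. X 0 \<omega> \<bullet> b)" for i
        using ident by metis
    qed (use int in auto)
    then show ?thesis using int by simp
  qed
  then have "AE \<omega> in M. \<forall>b\<in>Basis. (\<lambda>n. (\<Sum>i<n. X i \<omega> \<bullet> b) / real n) \<longlonglongrightarrow> expectation (X 0) \<bullet> b"
    by (intro AE_finite_allI) auto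
  then show ?thesis
  proof eventually_elim
    case (elim \<omega>)
    then show ?case
      by (subst tendsto_componentwise_iff) (simp add: inner_sum_left divide_inverse mult.commute)
  qed
qed

text \<open>
  The same law with the steps numbered from one, as in the definition of the walk.
\<close>
lemma (in prob_space) strong_law_from_1:
  fixes X :: "nat \<Rightarrow> 'a \<Rightarrow> 'b::euclidean_space"
  assumes indep: "indep_vars (\<lambda>_. borel) X UNIV"
    and ident: "\<And>k. distr M borel (X k) = distr M borel (X 0)"
    and int: "integrable M (X 0)"
  shows "AE \<omega> in M. (\<lambda>n. (\<Sum>k=1..n. X k \<omega>) /\<^sub>R real n) \<longlonglongrightarrow> expectation (X 0)"
proof -
  have rv: "X k \<in> borel_measurable M" for k using indep by (simp add: indep_vars_def2)
  have "AE \<omega> in M. (\<lambda>n. (\<Sum>i<n. X (Suc i) \<omega>) /\<^sub>R real n) \<longlonglongrightarrow> expectation (X (Suc 0))"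
  proof (rule strong_law)
    show "indep_vars (\<lambda>_. borel) (\<lambda>i. X (Suc i)) UNIV"
      using indep_vars_reindex[OF indep, of Suc UNIV] by simp
    show "distr M borel (X (Suc i)) = distr M borel (X (Suc 0))" for i using ident by metis
    show "integrable M (X (Suc 0))" by (rule ident_distr_integrable(1)[of X, OF rv ident int])
  qed
  moreover have "expectation (X (Suc 0)) = expectation (X 0)"
    by (rule ident_distr_integrable(2)[of X, OF rv ident int])
  ultimately show ?thesis by (simp add: sum.atLeast1_atMost_eq)
qed

section \<open>Convergence in mean under a converging majorant\<close>

text \<open>
  The majorants converge in mean by Scheffe's lemma. Truncating \<open>F n\<close> to the interval from \<open>- g\<close> to \<open>g\<close>
  gives functions \<open>h n\<close> to which dominated convergence with the fixed majorant \<open>2 * \<bar>g\<bar>\<close> applies, and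
  the truncation changes \<open>F n\<close> by at most \<open>\<bar>G n - g\<bar>\<close>.
\<close>
lemma generalized_dominated_convergence_L1:
  fixes f :: "'a \<Rightarrow> real"
  assumes fm[measurable]: "\<And>n. F n \<in> borel_measurable M" "f \<in> borel_measurable M"
    and G: "\<And>n. integrable M (G n)" "integrable M g"
    and bound: "\<And>n. AE x in M. \<bar>F n x\<bar> \<le> G n x"
    and limF: "AE x in M. (\<lambda>n. F n x) \<longlonglongrightarrow> f x"
    and limG: "AE x in M. (\<lambda>n. G n x) \<longlonglongrightarrow> g x"
    and limI: "(\<lambda>n. integral\<^sup>L M (G n)) \<longlonglongrightarrow> integral\<^sup>L M g"
  shows "(\<lambda>n. \<integral>x. \<bar>F n x - f x\<bar> \<partial>M) \<longlonglongrightarrow> 0"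
proof -
  have [measurable]: "G n \<in> borel_measurable M" "g \<in> borel_measurable M" for n
    using G by auto
  have bound': "AE x in M. \<forall>n. \<bar>F n x\<bar> \<le> G n x" using bound by (simp add: AE_all_countable)
  have fg: "AE x in M. \<bar>f x\<bar> \<le> g x"
    using bound' limF limG
  proof eventually_elim
    case (elim x)
    then show ?case by (intro LIMSEQ_le[OF tendsto_rabs[OF elim(2)] elim(3)]) auto
  qed
  have "(\<lambda>n. \<integral>\<^sup>+x. norm (G n x - g x) \<partial>M) \<longlonglongrightarrow> 0"
  proof (rule Scheffe_lemma1[OF G limG])
    have "(\<integral>\<^sup>+x. norm (G n x) \<partial>M) = ennreal (integral\<^sup>L M (G n))" for n
    proof -
      have "AE x in M. 0 \<le> G n x" using bound[of n] by eventually_elim linarith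
      then show ?thesis
        using nn_integral_eq_integral[OF G(1)] by (subst nn_integral_cong_AE[where v="\<lambda>x. ennreal (G n x)"]) auto
    qed
    moreover have "(\<integral>\<^sup>+x. norm (g x) \<partial>M) = ennreal (integral\<^sup>L M g)"
    proof -
      have "AE x in M. 0 \<le> g x" using fg by eventually_elim linarith
      then show ?thesis
        using nn_integral_eq_integral[OF G(2)] by (subst nn_integral_cong_AE[where v="\<lambda>x. ennreal (g x)"]) auto
    qed
    moreover have "limsup (\<lambda>n. ennreal (integral\<^sup>L M (G n))) = ennreal (integral\<^sup>L M g)"
      using limI by (intro lim_imp_Limsup tendsto_ennrealI) auto
    ultimately show "limsup (\<lambda>n. \<integral>\<^sup>+x. norm (G n x) \<partial>M) \<le> (\<integral>\<^sup>+x. norm (g x) \<partial>M)" by simp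
  qed
  moreover have "(\<integral>\<^sup>+x. norm (G n x - g x) \<partial>M) = ennreal (\<integral>x. \<bar>G n x - g x\<bar> \<partial>M)" for n
    using G by (simp add: nn_integral_eq_integral)
  ultimately have 1: "(\<lambda>n. \<integral>x. \<bar>G n x - g x\<bar> \<partial>M) \<longlonglongrightarrow> 0"
    using tendsto_ennreal_iff[of "\<lambda>n. \<integral>x. \<bar>G n x - g x\<bar> \<partial>M" sequentially 0] by simp
  define h where "h n x = max (- g x) (min (F n x) (g x))" for n x
  have [measurable]: "h n \<in> borel_measurable M" for n unfolding h_def by measurable
  have hb: "AE x in M. \<bar>h n x - f x\<bar> \<le> 2 * \<bar>g x\<bar>" for n
    using fg
  proof eventually_elim
    case (elim x)
    then have "\<bar>h n x\<bar> \<le> g x" by (auto simp: h_def max_def min_def)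
    with elim show ?case by linarith
  qed
  have 2: "(\<lambda>n. \<integral>x. \<bar>h n x - f x\<bar> \<partial>M) \<longlonglongrightarrow> (\<integral>x. 0 \<partial>M)"
  proof (rule integral_dominated_convergence)
    show "integrable M (\<lambda>x. 2 * \<bar>g x\<bar>)" using G by simp
    show "AE x in M. norm \<bar>h n x - f x\<bar> \<le> 2 * \<bar>g x\<bar>" for n using hb[of n] by simp
    show "AE x in M. (\<lambda>n. \<bar>h n x - f x\<bar>) \<longlonglongrightarrow> 0"
      using limF fg
    proof eventually_elim
      case (elim x)
      have "(\<lambda>n. h n x) \<longlonglongrightarrow> max (- g x) (min (f x) (g x))"
        unfolding h_def by (intro tendsto_intros elim)
      also have "max (- g x) (min (f x) (g x)) = f x" using elim(2) by (simp add: abs_le_iff max_def min_def)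
      finally show ?case using tendsto_rabs_zero LIM_zero by blast
    qed
  qed auto
  have inth: "integrable M (\<lambda>x. \<bar>h n x - f x\<bar>)" for n
  proof (rule Bochner_Integration.integrable_bound)
    show "integrable M (\<lambda>x. 2 * g x)" using G(2) by simp
    show "AE x in M. norm \<bar>h n x - f x\<bar> \<le> norm (2 * g x)"
      using hb[of n] by eventually_elim simp
  qed measurable
  have intG: "integrable M (\<lambda>x. \<bar>G n x - g x\<bar>)" for n using G by simp
  have le: "(\<integral>x. \<bar>F n x - f x\<bar> \<partial>M) \<le> (\<integral>x. \<bar>G n x - g x\<bar> \<partial>M) + (\<integral>x. \<bar>h n x - f x\<bar> \<partial>M)" for n
  proof -
    have "AE x in M. \<bar>F n x - f x\<bar> \<le> \<bar>G n x - g x\<bar> + \<bar>h n x - f x\<bar>"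
      using bound[of n] fg
    proof eventually_elim
      case (elim x)
      then have "\<bar>F n x - h n x\<bar> \<le> \<bar>G n x - g x\<bar>" by (auto simp: h_def max_def min_def)
      then show ?case by linarith
    qed
    then have "(\<integral>x. \<bar>F n x - f x\<bar> \<partial>M) \<le> (\<integral>x. \<bar>G n x - g x\<bar> + \<bar>h n x - f x\<bar> \<partial>M)"
      using intG[of n] inth[of n] by (intro integral_mono_AE') auto
    then show ?thesis using intG[of n] inth[of n] by simp
  qed
  show ?thesis
  proof (rule tendsto_sandwich[OF _ _ tendsto_const])
    show "(\<lambda>n. (\<integral>x. \<bar>G n x - g x\<bar> \<partial>M) + (\<integral>x. \<bar>h n x - f x\<bar> \<partial>M)) \<longlonglongrightarrow> 0"
      using tendsto_add[OF 1 2] by simp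
  qed (auto simp: le)
qed

section \<open>The perimeter of the convex hull of a random walk\<close>

text \<open>
  The integral formula turns the perimeter, a sum over edges that vary with the sample point, into a
  parameter integral of a jointly measurable function.
\<close>
lemma borel_measurable_hull_perimeter:
  assumes [measurable]: "\<And>k. Z k \<in> borel_measurable M"
  shows "hull_perimeter Z n \<in> borel_measurable M"
proof -
  interpret finite_measure unit_disc by (rule finite_measure_unit_disc)
  have [measurable]: "(\<lambda>\<omega>. walk Z k \<omega>) \<in> borel_measurable M" for k unfolding walk_def by measurable
  have snd[measurable]: "snd \<in> borel_measurable (M \<Otimes>\<^sub>M unit_disc)"
    by (rule measurable_compose[OF measurable_snd]) (auto intro: measurable_restrict_space1)
  have "(\<lambda>\<omega>. \<integral>x. Max ((\<lambda>k. x \<bullet> walk Z k \<omega>) ` {0..n}) - Min ((\<lambda>k. x \<bullet> walk Z k \<omega>) ` {0..n}) \<partial>unit_disc)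
      \<in> borel_measurable M" (is "?I \<in> _")
  proof (rule borel_measurable_lebesgue_integral)
    show "(\<lambda>(\<omega>, x). Max ((\<lambda>k. x \<bullet> walk Z k \<omega>) ` {0..n}) - Min ((\<lambda>k. x \<bullet> walk Z k \<omega>) ` {0..n}))
      \<in> borel_measurable (M \<Otimes>\<^sub>M unit_disc)"
      unfolding split_beta
      by (intro borel_measurable_diff borel_measurable_Max borel_measurable_Min borel_measurable_inner
          snd measurable_compose[OF measurable_fst]) auto
  qed
  moreover have "hull_perimeter Z n = (\<lambda>\<omega>. 2 / disc_abs_inner * ?I \<omega>)"
  proof
    fix \<omega>
    show "hull_perimeter Z n \<omega> = 2 / disc_abs_inner * ?I \<omega>"
      unfolding hull_perimeter_def walk_hull_def width_hull_image[symmetric]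
      by (rule perimeter_eq[OF polytope_hull_image]) simp
  qed
  ultimately show ?thesis by simp
qed

lemma hull_perimeter_nonneg: "0 \<le> hull_perimeter Z n \<omega>"
  using perimeter_ge_double_dist[OF polytope_hull_image, of "walk Z 0 \<omega>" "\<lambda>k. walk Z k \<omega>" n "walk Z 0 \<omega>"]
    hull_inc[of "walk Z 0 \<omega>" "(\<lambda>k. walk Z k \<omega>) ` {0..n}" convex]
  by (auto simp: hull_perimeter_def walk_hull_def)

lemma hull_perimeter_le: "hull_perimeter Z n \<omega> \<le> 2 * (\<Sum>i=1..n. norm (Z i \<omega>))"
  unfolding hull_perimeter_def walk_hull_def walk_def by (rule perimeter_hull_partial_sums_le)

lemma hull_perimeter_ge_step:
  assumes "n \<ge> 1"
  shows "2 * norm (Z n \<omega>) \<le> hull_perimeter Z n \<omega>"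
proof -
  obtain m where m: "n = Suc m" using assms by (cases n) auto
  have "walk Z k \<omega> \<in> walk_hull Z n \<omega>" if "k \<le> n" for k
    unfolding walk_hull_def using that by (intro hull_inc) auto
  then have "2 * dist (walk Z (Suc m) \<omega>) (walk Z m \<omega>) \<le> hull_perimeter Z n \<omega>"
    unfolding hull_perimeter_def using m polytope_hull_image
    by (intro perimeter_ge_double_dist) (auto simp: walk_hull_def)
  then show ?thesis by (simp add: m walk_def dist_norm)
qed

lemma hull_perimeter_over_n_le:
  "hull_perimeter Z n \<omega> / real n \<le> 2 * ((\<Sum>k=1..n. norm (Z k \<omega>)) / real n)"
  using divide_right_mono[OF hull_perimeter_le[of Z n \<omega>], of "real n"] by simp

theorem theorem1p1:
  fixes M :: "'a measure" and Z :: "nat \<Rightarrow> 'a \<Rightarrow> real^2"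
  assumes "prob_space M"
    and "prob_space.indep_vars M (\<lambda>_. borel) Z UNIV"
    and "\<And>k. distr M borel (Z k) = distr M borel (Z 0)"
  shows
    "((\<integral>\<^sup>+\<omega>. ennreal (norm (Z 0 \<omega>)) \<partial>M) < \<infinity> \<longrightarrow>
       (let \<mu> = (\<integral>\<omega>. Z 0 \<omega> \<partial>M) in
         (AE \<omega> in M. (\<lambda>n. hull_perimeter Z n \<omega> / real n) \<longlonglongrightarrow> 2 * norm \<mu>) \<and>
         (\<forall>n. integrable M (hull_perimeter Z n)) \<and>
         (\<lambda>n. \<integral>\<omega>. \<bar>hull_perimeter Z n \<omega> / real n - 2 * norm \<mu>\<bar> \<partial>M) \<longlonglongrightarrow> 0)) \<and>
     ((\<integral>\<^sup>+\<omega>. ennreal (norm (Z 0 \<omega>)) \<partial>M) = \<infinity> \<longrightarrow>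
       (AE \<omega> in M. limsup (\<lambda>n. ereal (hull_perimeter Z n \<omega> / real n)) = \<infinity>))"
proof -
  interpret prob_space M by fact
  note indep = assms(2) and ident = assms(3)
  have rv[measurable]: "Z k \<in> borel_measurable M" for k using indep by (simp add: indep_vars_def2)
  have Lm[measurable]: "hull_perimeter Z n \<in> borel_measurable M" for n
    by (rule borel_measurable_hull_perimeter) (rule rv)
  have "(AE \<omega> in M. (\<lambda>n. hull_perimeter Z n \<omega> / real n) \<longlonglongrightarrow> 2 * norm (expectation (Z 0))) \<and>
         (\<forall>n. integrable M (hull_perimeter Z n)) \<and>
         (\<lambda>n. \<integral>\<omega>. \<bar>hull_perimeter Z n \<omega> / real n - 2 * norm (expectation (Z 0))\<bar> \<partial>M) \<longlonglongrightarrow> 0"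
    if fin: "(\<integral>\<^sup>+\<omega>. ennreal (norm (Z 0 \<omega>)) \<partial>M) < \<infinity>"
  proof (intro conjI allI)
    have int0: "integrable M (Z 0)" using fin by (intro integrableI_bounded) auto
    have intN: "integrable M (\<lambda>\<omega>. norm (Z k \<omega>))" for k
      using ident_distr_integrable(1)[of Z, OF rv ident int0] by (rule integrable_norm)
    show lim: "AE \<omega> in M. (\<lambda>n. hull_perimeter Z n \<omega> / real n) \<longlonglongrightarrow> 2 * norm (expectation (Z 0))"
      using strong_law_from_1[OF indep ident int0]
    proof eventually_elim
      case (elim \<omega>)
      then show ?case
        unfolding hull_perimeter_def walk_hull_def
        by (intro tendsto_perimeter_hull) (simp_all add: walk_def)
    qed
    show "integrable M (hull_perimeter Z n)" for n
    proof (rule Bochner_Integration.integrable_bound)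
      show "integrable M (\<lambda>\<omega>. 2 * (\<Sum>k=1..n. norm (Z k \<omega>)))" using intN by auto
      show "AE \<omega> in M. norm (hull_perimeter Z n \<omega>) \<le> norm (2 * (\<Sum>k=1..n. norm (Z k \<omega>)))"
        using hull_perimeter_le[of Z n] hull_perimeter_nonneg[of Z n]
        by (intro AE_I2) (simp add: sum_nonneg)
    qed (rule Lm)
    have identN: "distr M borel (\<lambda>\<omega>. norm (Z k \<omega>)) = distr M borel (\<lambda>\<omega>. norm (Z 0 \<omega>))" for k
    proof -
      have "distr M borel (\<lambda>\<omega>. norm (Z k \<omega>)) = distr (distr M borel (Z k)) borel norm" for k
        by (subst distr_distr) (auto simp: comp_def)
      then show ?thesis using ident by metis
    qed
    have indepN: "indep_vars (\<lambda>_. borel) (\<lambda>k \<omega>. norm (Z k \<omega>)) UNIV"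
      using indep by (rule indep_vars_compose2) auto
    define m where "m = expectation (\<lambda>\<omega>. norm (Z 0 \<omega>))"
    define G where "G n \<omega> = 2 * ((\<Sum>k=1..n. norm (Z k \<omega>)) / real n)" for n \<omega>
    show "(\<lambda>n. \<integral>\<omega>. \<bar>hull_perimeter Z n \<omega> / real n - 2 * norm (expectation (Z 0))\<bar> \<partial>M) \<longlonglongrightarrow> 0"
    proof (rule generalized_dominated_convergence_L1[where G=G and g="\<lambda>_. 2 * m"])
      show "integrable M (G n)" for n unfolding G_def using intN by auto
      show "AE \<omega> in M. \<bar>hull_perimeter Z n \<omega> / real n\<bar> \<le> G n \<omega>" for n
        using hull_perimeter_over_n_le[of Z n] hull_perimeter_nonneg[of Z n]
        by (intro AE_I2) (simp add: G_def)
      have "AE \<omega> in M. (\<lambda>n. (\<Sum>k=1..n. norm (Z k \<omega>)) /\<^sub>R real n) \<longlonglongrightarrow> m"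
        unfolding m_def by (rule strong_law_from_1[OF indepN identN intN])
      then show "AE \<omega> in M. (\<lambda>n. G n \<omega>) \<longlonglongrightarrow> 2 * m"
      proof eventually_elim
        case (elim \<omega>)
        from tendsto_mult_left[OF this, of 2] show ?case
          by (simp add: G_def divide_inverse mult.commute)
      qed
      \<comment> \<open>At \<open>n = 0\<close> the division by zero makes \<open>G n\<close> vanish, so the means agree only from \<open>n = 1\<close> on.\<close>
      have "expectation (G n) = 2 * m" if "n \<ge> 1" for n
      proof -
        have "expectation (\<lambda>\<omega>. norm (Z k \<omega>)) = m" for k
          unfolding m_def using ident_distr_integrable(2)[of "\<lambda>k \<omega>. norm (Z k \<omega>)", OF _ identN intN] by simp
        then show ?thesis using intN that by (simp add: G_def[abs_def])
      qed
      then have "expectation (G n) = expectation (\<lambda>_. 2 * m)" if "n \<ge> 1" for n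
        using that by (simp add: prob_space)
      then show "(\<lambda>n. expectation (G n)) \<longlonglongrightarrow> expectation (\<lambda>_. 2 * m)"
        by (intro tendsto_eventually) (auto simp: eventually_sequentially)
    qed (use lim in auto)
  qed
  moreover have "AE \<omega> in M. limsup (\<lambda>n. ereal (hull_perimeter Z n \<omega> / real n)) = \<infinity>"
    if inf: "(\<integral>\<^sup>+\<omega>. ennreal (norm (Z 0 \<omega>)) \<partial>M) = \<infinity>"
  proof -
    have "AE \<omega> in M. \<exists>\<^sub>\<infinity>n. real (Suc c) * real n \<le> norm (Z n \<omega>)" for c
    proof -
      define A where "A n = {z::real^2. real (Suc c) * real n \<le> norm z}" for n
      have A[measurable]: "A n \<in> sets borel" for n unfolding A_def by measurable
      have same: "prob {\<omega>\<in>space M. Z n \<omega> \<in> A n} = prob {\<omega>\<in>space M. real n \<le> norm (Z 0 \<omega>) / real (Suc c)}" for n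
      proof -
        have "prob {\<omega>\<in>space M. Z k \<omega> \<in> A n} = measure (distr M borel (Z k)) (A n)" for k
          by (simp add: measure_distr vimage_def Int_def conj_commute)
        then have "prob {\<omega>\<in>space M. Z n \<omega> \<in> A n} = prob {\<omega>\<in>space M. Z 0 \<omega> \<in> A n}"
          using ident by metis
        then show ?thesis by (simp add: A_def pos_le_divide_eq mult.commute)
      qed
      have "\<not> summable (\<lambda>n. prob {\<omega>\<in>space M. Z n \<omega> \<in> A n})"
      proof
        assume "summable (\<lambda>n. prob {\<omega>\<in>space M. Z n \<omega> \<in> A n})"
        then have "(\<integral>\<^sup>+\<omega>. ennreal (norm (Z 0 \<omega>) / real (Suc c)) \<partial>M) < \<infinity>"
          unfolding same by (intro nn_integral_finite_of_summable_tails) auto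
        then have "ennreal (real (Suc c)) * (\<integral>\<^sup>+\<omega>. ennreal (norm (Z 0 \<omega>) / real (Suc c)) \<partial>M) < \<infinity>"
          by (simp add: ennreal_mult_less_top)
        also have "ennreal (real (Suc c)) * (\<integral>\<^sup>+\<omega>. ennreal (norm (Z 0 \<omega>) / real (Suc c)) \<partial>M)
            = (\<integral>\<^sup>+\<omega>. ennreal (norm (Z 0 \<omega>)) \<partial>M)"
          by (subst nn_integral_cmult[symmetric]) (simp_all add: ennreal_mult[symmetric] del: of_nat_Suc)
        finally show False using inf by simp
      qed
      then have "AE \<omega> in M. \<exists>\<^sub>\<infinity>n. Z n \<omega> \<in> A n"
        by (intro borel_cantelli_indep_vars[OF indep]) auto
      then show ?thesis by (simp add: A_def)
    qed
    then have "AE \<omega> in M. \<forall>c. \<exists>\<^sub>\<infinity>n. real (Suc c) * real n \<le> norm (Z n \<omega>)"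
      by (simp add: AE_all_countable)
    then show ?thesis
    proof eventually_elim
      case (elim \<omega>)
      show ?case
      proof (rule ccontr)
        assume "limsup (\<lambda>n. ereal (hull_perimeter Z n \<omega> / real n)) \<noteq> \<infinity>"
        then obtain c :: nat where c: "limsup (\<lambda>n. ereal (hull_perimeter Z n \<omega> / real n)) < ereal (real c)"
          using less_PInf_Ex_of_nat by auto
        have "eventually (\<lambda>n. ereal (hull_perimeter Z n \<omega> / real n) < ereal (real c)) sequentially"
          by (rule Limsup_lessD[OF c])
        then have "eventually (\<lambda>n. \<not> real (Suc c) * real n \<le> norm (Z n \<omega>)) sequentially"
          using eventually_ge_at_top[of 1]
        proof eventually_elim
          case (elim n)
          then have "hull_perimeter Z n \<omega> < real c * real n" by (simp add: pos_divide_less_eq)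
          then have "2 * norm (Z n \<omega>) < real c * real n"
            using hull_perimeter_ge_step[OF elim(2), of Z \<omega>] by linarith
          moreover have "real c * real n \<le> 2 * (real (Suc c) * real n)" by (simp add: algebra_simps)
          ultimately show ?case by linarith
        qed
        then have "\<not> (\<exists>\<^sub>\<infinity>n. real (Suc c) * real n \<le> norm (Z n \<omega>))"
          unfolding cofinite_eq_sequentially frequently_def by simp
        with elim show False by blast
      qed
    qed
  qed
  ultimately show ?thesis by (simp add: Let_def)
qed

end
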